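(* Assume the Set Cover Conjecture. Then for every $\epsilon>0$ there is a constant $k$ such that no algorithm solves Polytree Learning with maximum parent set size $k$ (PT$_{\le}$) in time $2^{(1-\epsilon)n}|\mathcal{I}|^{\mathcal{O}(1)}$. Furthermore, assuming the Set Cover Conjecture, for every $\epsilon>0$ no algorithm solves Polytree Learning (PT) in time $2^{(1-\epsilon)n}|\mathcal{I}|^{\mathcal{O}(1)}$.
   Context: A DAG $D=(V,A)$ is a polytree if its skeleton is a forest; $D_v$ is the parent set of $v$. Polytree Learning (PT): input is a node set $V$, $|V|=n$, and for each $v\in V$ a family $\mathcal{F}_v$ of potential parent sets with scores $f_v(S)\in\mathbb{R}$ for $S\in\mathcal{F}_v$ (non-zero encoding; $f_v(S)=-\infty$ for $S\notin\mathcal{F}_v$; $\emptyset\in\mathcal{F}_v$ with $f_v(\emptyset)=0$). The score of $D$ is $f(D)=\sum_v f_v(D_v)$; the goal is a polytree of maximum score. PT$_{\le}$ is the variant where every set in every $\mathcal{F}_v$ has size at most $k$. $|\mathcal{I}|$ is the input encoding length. $k'$-Set Cover: given a universe of size $n'$, a family of its subsets each of size at most $k'$, and $t\le n'$, decide whether $t$ of the subsets have union equal to the universe. Set Cover Conjecture: for every $\epsilon>0$ there is a positive integer $k'$ such that no algorithm solves $k'$-Set Cover in time $\mathcal{O}(2^{(1-\epsilon)n'})$. *)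

theory Defs
  imports Complex_Main "HOL-Library.Extended_Real"
begin

section \<open>Machine model\<close>

text \<open>
  Algorithms are programs of the WHILE language over binary trees (N. D. Jones,
  \<^emph>\<open>Computability and Complexity from a Programming Perspective\<close>) with unit cost for every
  elementary operation and every test. As trees are immutable and can only be compared with
  \<open>Leaf\<close>, a step takes constant time on a pointer representation with sharing; conversely,
  storing the memory of a word RAM in a binary trie indexed by the bits of the addresses simulates a
  RAM running in time \<open>T\<close> with overhead polylogarithmic in \<open>T\<close>. Exponential time bounds are
  therefore the same as on the word RAM up to factors polynomial in the exponent. Algorithms are
  deterministic.
\<close>

datatype data = Leaf | Pair data data

fun hd_data :: "data \<Rightarrow> data" where
  "hd_data Leaf = Leaf"
| "hd_data (Pair a b) = a"

fun tl_data :: "data \<Rightarrow> data" where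
  "tl_data Leaf = Leaf"
| "tl_data (Pair a b) = b"

type_synonym var = nat
type_synonym store = "var \<Rightarrow> data"

datatype com =
    Skip
  | SetLeaf var
  | Copy var var
  | SetPair var var var
  | SetHd var var
  | SetTl var var
  | Seq com com
  | If var com com
  | While var com

text \<open>\<open>exec c s n s'\<close>: started in \<open>s\<close>, the program \<open>c\<close> halts in \<open>s'\<close> after exactly \<open>n\<close> steps.\<close>

inductive exec :: "com \<Rightarrow> store \<Rightarrow> nat \<Rightarrow> store \<Rightarrow> bool" where
  Skip: "exec Skip s 1 s"
| SetLeaf: "exec (SetLeaf x) s 1 (s(x := Leaf))"
| Copy: "exec (Copy x y) s 1 (s(x := s y))"
| SetPair: "exec (SetPair x y z) s 1 (s(x := Pair (s y) (s z)))"
| SetHd: "exec (SetHd x y) s 1 (s(x := hd_data (s y)))"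
| SetTl: "exec (SetTl x y) s 1 (s(x := tl_data (s y)))"
| Seq: "exec c1 s1 m s2 \<Longrightarrow> exec c2 s2 n s3 \<Longrightarrow> exec (Seq c1 c2) s1 (m + n) s3"
| IfTrue: "s x \<noteq> Leaf \<Longrightarrow> exec c1 s n s' \<Longrightarrow> exec (If x c1 c2) s (1 + n) s'"
| IfFalse: "s x = Leaf \<Longrightarrow> exec c2 s n s' \<Longrightarrow> exec (If x c1 c2) s (1 + n) s'"
| WhileFalse: "s x = Leaf \<Longrightarrow> exec (While x c) s 1 s"
| WhileTrue: "s1 x \<noteq> Leaf \<Longrightarrow> exec c s1 m s2 \<Longrightarrow> exec (While x c) s2 n s3 \<Longrightarrow>
    exec (While x c) s1 (1 + m + n) s3"

lemma exec_deterministic: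
  "exec c s n t \<Longrightarrow> exec c s n' t' \<Longrightarrow> n' = n \<and> t' = t"
proof (induction arbitrary: n' t' rule: exec.induct)
  case (Seq c1 s1 m s2 c2 n s3)
  from Seq.prems show ?case by cases (use Seq.IH in blast)
next
  case (IfTrue s x c1 n s' c2)
  from IfTrue.prems show ?case by cases (use IfTrue in blast)+
next
  case (IfFalse s x c2 n s' c1)
  from IfFalse.prems show ?case by cases (use IfFalse in blast)+
next
  case (WhileTrue s1 x c m s2 n s3)
  from WhileTrue.prems show ?case by cases (use WhileTrue in blast)+
qed (auto elim: exec.cases)

text \<open>Variable \<open>0\<close> holds the input and, on termination, the output; all other variables are
  initially \<open>Leaf\<close>.\<close>

definition outputs_within :: "com \<Rightarrow> data \<Rightarrow> real \<Rightarrow> data \<Rightarrow> bool" where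
  "outputs_within p x T y \<longleftrightarrow>
    (\<exists>n s. exec p ((\<lambda>_. Leaf)(0 := x)) n s \<and> real n \<le> T \<and> s 0 = y)"

definition solves_in_time ::
    "com \<Rightarrow> 'i set \<Rightarrow> ('i \<Rightarrow> data) \<Rightarrow> ('i \<Rightarrow> data \<Rightarrow> bool) \<Rightarrow> ('i \<Rightarrow> real) \<Rightarrow> bool" where
  "solves_in_time p Inst enc correct T \<longleftrightarrow>
    (\<forall>I\<in>Inst. \<exists>y. outputs_within p (enc I) (T I) y \<and> correct I y)"

section \<open>Encodings\<close>

text \<open>The number of nodes of a tree, which is also the length of its preorder bit string (one bit
  per node).\<close>

fun enc_length :: "data \<Rightarrow> nat" where
  "enc_length Leaf = 1"
| "enc_length (Pair a b) = 1 + enc_length a + enc_length b"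

fun enc_bool :: "bool \<Rightarrow> data" where
  "enc_bool False = Leaf"
| "enc_bool True = Pair Leaf Leaf"

fun enc_list :: "('a \<Rightarrow> data) \<Rightarrow> 'a list \<Rightarrow> data" where
  "enc_list e [] = Leaf"
| "enc_list e (x # xs) = Pair (e x) (enc_list e xs)"

text \<open>Numbers are written in binary, least significant bit first.\<close>

fun enc_nat :: "nat \<Rightarrow> data" where
  "enc_nat n = (if n = 0 then Leaf else Pair (enc_bool (odd n)) (enc_nat (n div 2)))"

declare enc_nat.simps [simp del]

definition enc_int :: "int \<Rightarrow> data" where
  "enc_int i = Pair (enc_bool (i < 0)) (enc_nat (nat \<bar>i\<bar>))"

definition enc_rat :: "rat \<Rightarrow> data" where
  "enc_rat q = (case quotient_of q of (a, b) \<Rightarrow> Pair (enc_int a) (enc_int b))"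

section \<open>Set Cover\<close>

text \<open>An instance \<open>(n, F, t)\<close> has universe \<open>{..<n}\<close>. Finite sets are given by repetition-free lists in
  any order, so for fixed \<open>k\<close> the encoding length is polynomial in \<open>n\<close>.\<close>

type_synonym sc_instance = "nat \<times> nat list list \<times> nat"

definition sc_instances :: "nat \<Rightarrow> sc_instance set" where
  "sc_instances k = {(n, F, t).
    (\<forall>S\<in>set F. distinct S \<and> set S \<subseteq> {..<n} \<and> card (set S) \<le> k) \<and>
    distinct (map set F) \<and> t \<le> n}"

definition enc_sc :: "sc_instance \<Rightarrow> data" where
  "enc_sc = (\<lambda>(n, F, t). Pair (enc_nat n) (Pair (enc_list (enc_list enc_nat) F) (enc_nat t)))"

definition has_set_cover :: "sc_instance \<Rightarrow> bool" where
  "has_set_cover = (\<lambda>(n, F, t). \<exists>C. C \<subseteq> set ` set F \<and> card C = t \<and> \<Union>C = {..<n})"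

definition sc_correct :: "sc_instance \<Rightarrow> data \<Rightarrow> bool" where
  "sc_correct I y \<longleftrightarrow> y = enc_bool (has_set_cover I)"

definition set_cover_conjecture :: bool where
  "set_cover_conjecture \<longleftrightarrow>
    (\<forall>\<epsilon>::real. \<epsilon> > 0 \<longrightarrow> (\<exists>k::nat. k > 0 \<and>
      \<not> (\<exists>p C. solves_in_time p (sc_instances k) enc_sc sc_correct
                (\<lambda>(n, F, t). C * 2 powr ((1 - \<epsilon>) * real n)))))"

section \<open>Polytrees\<close>

definition skeleton :: "('a \<times> 'a) set \<Rightarrow> 'a set set" where
  "skeleton A = {{u, v} | u v. (u, v) \<in> A}"

definition is_cycle :: "'a set set \<Rightarrow> 'a list \<Rightarrow> bool" where
  "is_cycle E xs \<longleftrightarrow> length xs \<ge> 3 \<and> distinct xs \<and>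
    (\<forall>i<length xs. {xs ! i, xs ! (Suc i mod length xs)} \<in> E)"

definition forest :: "'a set set \<Rightarrow> bool" where
  "forest E \<longleftrightarrow> (\<nexists>xs. is_cycle E xs)"

definition dag :: "'a set \<Rightarrow> ('a \<times> 'a) set \<Rightarrow> bool" where
  "dag V A \<longleftrightarrow> A \<subseteq> V \<times> V \<and> acyclic A"

definition polytree :: "'a set \<Rightarrow> ('a \<times> 'a) set \<Rightarrow> bool" where
  "polytree V A \<longleftrightarrow> dag V A \<and> forest (skeleton A)"

definition parents :: "('a \<times> 'a) set \<Rightarrow> 'a \<Rightarrow> 'a set" where
  "parents A v = {u. (u, v) \<in> A}"

section \<open>Polytree Learning\<close>

text \<open>The nodes of an instance \<open>I\<close> are \<open>{..<length I}\<close>, and \<open>I ! v\<close> lists the potential parent sets of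
  \<open>v\<close> with their scores. Scores are rational so that instances have a finite encoding.\<close>

type_synonym pt_instance = "(nat list \<times> rat) list list"

definition nodes :: "pt_instance \<Rightarrow> nat set" where
  "nodes I = {..<length I}"

definition potential_parents :: "pt_instance \<Rightarrow> nat \<Rightarrow> nat set set" where
  "potential_parents I v = (\<lambda>(S, q). set S) ` set (I ! v)"

definition local_score :: "pt_instance \<Rightarrow> nat \<Rightarrow> nat set \<Rightarrow> ereal" where
  "local_score I v S =
    (case map_of (map (\<lambda>(S, q). (set S, q)) (I ! v)) S of
       Some q \<Rightarrow> ereal (real_of_rat q)
     | None \<Rightarrow> -\<infinity>)"

definition score :: "pt_instance \<Rightarrow> (nat \<times> nat) set \<Rightarrow> ereal" where
  "score I A = (\<Sum>v\<in>nodes I. local_score I v (parents A v))"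

definition pt_instances :: "pt_instance set" where
  "pt_instances = {I. \<forall>v\<in>nodes I.
    (\<forall>(S, q)\<in>set (I ! v). distinct S \<and> set S \<subseteq> nodes I - {v}) \<and>
    distinct (map (\<lambda>(S, q). set S) (I ! v)) \<and>
    {} \<in> potential_parents I v \<and> local_score I v {} = 0}"

definition pt_le_instances :: "nat \<Rightarrow> pt_instance set" where
  "pt_le_instances k =
    {I \<in> pt_instances. \<forall>v\<in>nodes I. \<forall>S\<in>potential_parents I v. card S \<le> k}"

definition enc_pt :: "pt_instance \<Rightarrow> data" where
  "enc_pt = enc_list (enc_list (\<lambda>(S, q). Pair (enc_list enc_nat S) (enc_rat q)))"

definition max_score_polytree :: "pt_instance \<Rightarrow> (nat \<times> nat) set \<Rightarrow> bool" where
  "max_score_polytree I A \<longleftrightarrow> polytree (nodes I) A \<and>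
    (\<forall>A'. polytree (nodes I) A' \<longrightarrow> score I A' \<le> score I A)"

text \<open>The output lists the parent sets of the nodes \<open>0, 1, \<dots>\<close> of a polytree of maximum score.\<close>

definition pt_correct :: "pt_instance \<Rightarrow> data \<Rightarrow> bool" where
  "pt_correct I y \<longleftrightarrow> (\<exists>A Ps. max_score_polytree I A \<and> length Ps = length I \<and>
    (\<forall>v\<in>nodes I. distinct (Ps ! v) \<and> set (Ps ! v) = parents A v) \<and>
    y = enc_list (enc_list enc_nat) Ps)"

text \<open>Solvability of the instances in \<open>Inst\<close> in time \<open>2 ^ ((1 - \<epsilon>) * n) * |I| ^ O(1)\<close>. The factor \<open>C\<close>
  is only relevant for the empty node set, where \<open>|I| = 1\<close>.\<close>

definition pt_solvable :: "real \<Rightarrow> pt_instance set \<Rightarrow> bool" where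
  "pt_solvable \<epsilon> Inst \<longleftrightarrow> (\<exists>p C c. solves_in_time p Inst enc_pt pt_correct
    (\<lambda>I. C * 2 powr ((1 - \<epsilon>) * real (card (nodes I))) * real (enc_length (enc_pt I)) ^ c))"

end

theory Submission
  imports Defs "HOL-Library.Multiset"
begin

text \<open>
  Given a Set Cover instance with universe \<open>{..<n}\<close> and budget \<open>t\<close>, fix a constant \<open>r\<close> and replace \<open>t\<close> by
  roughly \<open>t / r\<close> selector nodes, most of which may choose as parents any set covered by \<open>r\<close> sets of
  the family, together with a common hub node; the score is the number of chosen elements.
  Two selectors that share an element would form a 4-cycle with the hub, so in a polytree the
  chosen sets are disjoint, the total score is the number of covered elements, and an optimal polytree covers
  the universe iff \<open>t\<close> sets suffice. The number of nodes is \<open>n + n / r + O(r)\<close>, so for large \<open>r\<close> an algorithm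
  with running time \<open>2 ^ ((1 - \<epsilon>) * N) * |I| ^ O(1)\<close> on \<open>N\<close> nodes beats \<open>2 ^ ((1 - \<epsilon> / 2) * n)\<close> for
  Set Cover. That the reduction runs in polynomial time on the WHILE machine follows from closure
  properties of polynomial-time functions, chiefly under folds over lists whose accumulator stays
  polynomially bounded.
\<close>

section \<open>Polynomial-time programs\<close>

text \<open>One selector per set of a cover may require \<open>n\<close> selectors, hence about
  \<open>2 * n\<close> nodes, and a lower bound would then reach only half the exponent; grouping
  \<open>r\<close> sets per selector makes the overhead an arbitrarily small fraction of
  \<open>n\<close>. The price is one option for every choice of elements, which stays polynomial
  because sets of bounded size \<open>k\<close> leave at most \<open>r * k\<close> elements per
  choice; this also keeps the parent sets of constant size. Disjointness costs nothing, since a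
  selector may take any part of what its sets cover. The second obstacle is the encoding:
  \<open>n\<close> and \<open>t\<close> are given in binary and may be exponentially larger than the
  input, so the nodes can be created only after a test that the family has at least \<open>t\<close>
  members and total size at least \<open>n\<close>; if it fails there is no cover. Conversely, Set
  Cover time is measured in \<open>n\<close>, so polynomials in the input length must be turned into
  polynomials in \<open>n\<close>. The claim about unrestricted parent sets follows because an
  algorithm for them also solves the bounded instances.\<close>

lemma enc_length_pos: "enc_length d \<ge> 1"
  by (cases d) auto

text \<open>One constant serves as factor and exponent, which loses nothing because encoding lengths
  are at least 1.\<close>

definition poly_bounded :: "('a \<Rightarrow> data) \<Rightarrow> ('a \<Rightarrow> nat) \<Rightarrow> bool" where
  "poly_bounded e g \<longleftrightarrow> (\<exists>c. \<forall>x. g x \<le> c * enc_length (e x) ^ c)"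

lemma poly_bounded_mono:
  assumes "poly_bounded e h" "\<And>x. g x \<le> h x"
  shows "poly_bounded e g"
  using assms unfolding poly_bounded_def by (meson le_trans)

lemma poly_bounded_const [intro]: "poly_bounded e (\<lambda>_. k)"
proof -
  have "k \<le> k * enc_length (e x) ^ k" for x
    using enc_length_pos[of "e x"] by simp
  then show ?thesis unfolding poly_bounded_def by blast
qed

lemma poly_bounded_enc_length [intro]: "poly_bounded e (\<lambda>x. enc_length (e x))"
  unfolding poly_bounded_def by (rule exI[of _ 1]) simp

lemma poly_bounded_add [intro]:
  assumes "poly_bounded e g" "poly_bounded e h"
  shows "poly_bounded e (\<lambda>x. g x + h x)"
proof -
  obtain c d where c: "\<And>x. g x \<le> c * enc_length (e x) ^ c"
    and d: "\<And>x. h x \<le> d * enc_length (e x) ^ d"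
    using assms unfolding poly_bounded_def by blast
  have "g x + h x \<le> (c + d) * enc_length (e x) ^ (c + d)" for x
  proof -
    let ?m = "enc_length (e x)"
    have "c * ?m ^ c \<le> c * ?m ^ (c + d)" "d * ?m ^ d \<le> d * ?m ^ (c + d)"
      using enc_length_pos[of "e x"] by (auto intro!: mult_left_mono power_increasing)
    then show ?thesis using c[of x] d[of x] unfolding distrib_right by linarith
  qed
  then show ?thesis unfolding poly_bounded_def by blast
qed

lemma poly_bounded_mult [intro]:
  assumes "poly_bounded e g" "poly_bounded e h"
  shows "poly_bounded e (\<lambda>x. g x * h x)"
proof -
  obtain c d where c: "\<And>x. g x \<le> c * enc_length (e x) ^ c"
    and d: "\<And>x. h x \<le> d * enc_length (e x) ^ d"
    using assms unfolding poly_bounded_def by blast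
  \<comment> \<open>The common constant has to dominate both the factor \<open>c * d\<close> and the
    exponent \<open>c + d\<close>.\<close>
  have "g x * h x \<le> (c * d + c + d) * enc_length (e x) ^ (c * d + c + d)" for x
  proof -
    let ?m = "enc_length (e x)"
    have "g x * h x \<le> (c * ?m ^ c) * (d * ?m ^ d)"
      using c[of x] d[of x] by (rule mult_mono) auto
    also have "\<dots> = (c * d) * ?m ^ (c + d)" by (simp add: power_add)
    also have "\<dots> \<le> (c * d + c + d) * ?m ^ (c * d + c + d)"
      using enc_length_pos[of "e x"] by (intro mult_mono power_increasing) auto
    finally show ?thesis .
  qed
  then show ?thesis unfolding poly_bounded_def by blast
qed

lemma poly_bounded_power [intro]:
  "poly_bounded e g \<Longrightarrow> poly_bounded e (\<lambda>x. g x ^ k)"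
  by (induction k) auto

lemma poly_bounded_comp:
  assumes "poly_bounded e' g" "poly_bounded e (\<lambda>x. enc_length (e' (f x)))"
  shows "poly_bounded e (\<lambda>x. g (f x))"
proof -
  obtain c where c: "\<And>x. g x \<le> c * enc_length (e' x) ^ c"
    using assms(1) unfolding poly_bounded_def by blast
  have "poly_bounded e (\<lambda>x. c * enc_length (e' (f x)) ^ c)"
    using assms(2) by auto
  then show ?thesis by (rule poly_bounded_mono) (rule c)
qed

lemmas poly_bounded_intros = poly_bounded_const poly_bounded_enc_length poly_bounded_add
  poly_bounded_mult poly_bounded_power

section \<open>Relocating programs to fresh registers\<close>

primrec rename :: "(var \<Rightarrow> var) \<Rightarrow> com \<Rightarrow> com" where
  "rename f Skip = Skip"
| "rename f (SetLeaf x) = SetLeaf (f x)"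
| "rename f (Copy x y) = Copy (f x) (f y)"
| "rename f (SetPair x y z) = SetPair (f x) (f y) (f z)"
| "rename f (SetHd x y) = SetHd (f x) (f y)"
| "rename f (SetTl x y) = SetTl (f x) (f y)"
| "rename f (Seq c d) = Seq (rename f c) (rename f d)"
| "rename f (If x c d) = If (f x) (rename f c) (rename f d)"
| "rename f (While x c) = While (f x) (rename f c)"

text \<open>An injective renaming commutes with every assignment, so the run is copied step by step;
  registers outside the range survive because no renamed instruction mentions them.\<close>

lemma exec_rename:
  assumes "exec c t n t'" "inj f" "t = s \<circ> f"
  shows "\<exists>s'. exec (rename f c) s n s' \<and> t' = s' \<circ> f \<and> (\<forall>v. v \<notin> range f \<longrightarrow> s' v = s v)"
  using assms
proof (induction arbitrary: s rule: exec.induct)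
  case (Seq c1 s1 m s2 c2 n s3)
  obtain u where u: "exec (rename f c1) s m u" "s2 = u \<circ> f" "\<forall>v. v \<notin> range f \<longrightarrow> u v = s v"
    using Seq by blast
  obtain w where "exec (rename f c2) u n w" "s3 = w \<circ> f" "\<forall>v. v \<notin> range f \<longrightarrow> w v = u v"
    using Seq u by blast
  then show ?case using u by (auto intro!: exI[of _ w] exec.intros)
next
  case (WhileTrue s1 x c m s2 n s3)
  obtain u where u: "exec (rename f c) s m u" "s2 = u \<circ> f" "\<forall>v. v \<notin> range f \<longrightarrow> u v = s v"
    using WhileTrue by blast
  obtain w where w: "exec (rename f (While x c)) u n w" "s3 = w \<circ> f"
    "\<forall>v. v \<notin> range f \<longrightarrow> w v = u v"
    using WhileTrue u by blast
  have "exec (rename f (While x c)) s (1 + m + n) w"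
    using exec.WhileTrue[of s "f x" "rename f c" m u n w] WhileTrue u w by auto
  then show ?case using u w by auto
next
  case (IfTrue t x c1 n t' c2)
  then obtain u where "exec (rename f c1) s n u" "t' = u \<circ> f"
    "\<forall>v. v \<notin> range f \<longrightarrow> u v = s v"
    by blast
  then show ?case using IfTrue.prems IfTrue.hyps
    by (intro exI[of _ u]) (simp add: exec.IfTrue[unfolded plus_1_eq_Suc])
next
  case (IfFalse t x c2 n t' c1)
  then obtain u where "exec (rename f c2) s n u" "t' = u \<circ> f"
    "\<forall>v. v \<notin> range f \<longrightarrow> u v = s v"
    by blast
  then show ?case using IfFalse.prems IfFalse.hyps
    by (intro exI[of _ u]) (simp add: exec.IfFalse[unfolded plus_1_eq_Suc])
next
  case (WhileFalse t x c)
  then show ?case using exec.WhileFalse[of s "f x" "rename f c"] by auto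
next
  case (Skip t)
  then show ?case using exec.Skip[of s] unfolding rename.simps by blast
next
  case (SetLeaf x t)
  let ?s = "s(f x := Leaf)"
  have "exec (rename f (SetLeaf x)) s 1 ?s"
    unfolding rename.simps by (rule exec.SetLeaf)
  moreover have "t(x := Leaf) = ?s \<circ> f"
    using SetLeaf by (auto simp: fun_eq_iff inj_eq)
  moreover have "\<forall>v. v \<notin> range f \<longrightarrow> ?s v = s v" by auto
  ultimately show ?case by blast
next
  case (Copy x y t)
  let ?s = "s(f x := s (f y))"
  have "exec (rename f (Copy x y)) s 1 ?s"
    unfolding rename.simps by (rule exec.Copy)
  moreover have "t(x := t y) = ?s \<circ> f"
    using Copy by (auto simp: fun_eq_iff inj_eq)
  moreover have "\<forall>v. v \<notin> range f \<longrightarrow> ?s v = s v" by auto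
  ultimately show ?case by blast
next
  case (SetPair x y z t)
  let ?s = "s(f x := Pair (s (f y)) (s (f z)))"
  have "exec (rename f (SetPair x y z)) s 1 ?s"
    unfolding rename.simps by (rule exec.SetPair)
  moreover have "t(x := Pair (t y) (t z)) = ?s \<circ> f"
    using SetPair by (auto simp: fun_eq_iff inj_eq)
  moreover have "\<forall>v. v \<notin> range f \<longrightarrow> ?s v = s v" by auto
  ultimately show ?case by blast
next
  case (SetHd x y t)
  let ?s = "s(f x := hd_data (s (f y)))"
  have "exec (rename f (SetHd x y)) s 1 ?s"
    unfolding rename.simps by (rule exec.SetHd)
  moreover have "t(x := hd_data (t y)) = ?s \<circ> f"
    using SetHd by (auto simp: fun_eq_iff inj_eq)
  moreover have "\<forall>v. v \<notin> range f \<longrightarrow> ?s v = s v" by auto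
  ultimately show ?case by blast
next
  case (SetTl x y t)
  let ?s = "s(f x := tl_data (s (f y)))"
  have "exec (rename f (SetTl x y)) s 1 ?s"
    unfolding rename.simps by (rule exec.SetTl)
  moreover have "t(x := tl_data (t y)) = ?s \<circ> f"
    using SetTl by (auto simp: fun_eq_iff inj_eq)
  moreover have "\<forall>v. v \<notin> range f \<longrightarrow> ?s v = s v" by auto
  ultimately show ?case by blast
qed

text \<open>A program moved up by \<open>d\<close> works as a subroutine with argument and result in
  register \<open>d\<close>; the registers below \<open>d\<close> are safe storage for the
  caller.\<close>

lemma exec_shift:
  assumes "exec c (\<lambda>v. s (v + d)) n t"
  shows "\<exists>s'. exec (rename (\<lambda>v. v + d) c) s n s' \<and> s' d = t 0 \<and> (\<forall>v<d. s' v = s v)"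
proof -
  have "inj (\<lambda>v. v + d)" by (simp add: inj_def)
  from exec_rename[OF assms this, of s] obtain s' where
    "exec (rename (\<lambda>v. v + d) c) s n s'" "t = s' \<circ> (\<lambda>v. v + d)"
    "\<forall>v. v \<notin> range (\<lambda>v. v + d) \<longrightarrow> s' v = s v"
    by (auto simp: fun_eq_iff)
  moreover have "v \<notin> range (\<lambda>v. v + d)" if "v < d" for v :: nat using that by auto
  ultimately show ?thesis by auto
qed

text \<open>The bound on the output size has to be demanded separately: since trees are shared, \<open>n\<close> steps can
  build a tree of size \<open>2 ^ n\<close>. The program may not rely on the variables other than \<open>0\<close> being
  \<open>Leaf\<close> initially.\<close>

definition ptime :: "('a \<Rightarrow> data) \<Rightarrow> ('a \<Rightarrow> data) \<Rightarrow> bool" where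
  "ptime e F \<longleftrightarrow> poly_bounded e (\<lambda>x. enc_length (F x)) \<and>
    (\<exists>p T. poly_bounded e T \<and>
      (\<forall>x s. s 0 = e x \<longrightarrow> (\<exists>n s'. exec p s n s' \<and> n \<le> T x \<and> s' 0 = F x)))"

lemma ptimeI:
  assumes "poly_bounded e (\<lambda>x. enc_length (F x))" "poly_bounded e T"
    and "\<And>x s. s 0 = e x \<Longrightarrow> \<exists>n s'. exec p s n s' \<and> n \<le> T x \<and> s' 0 = F x"
  shows "ptime e F"
  using assms unfolding ptime_def by blast

lemma ptime_size: "ptime e F \<Longrightarrow> poly_bounded e (\<lambda>x. enc_length (F x))"
  unfolding ptime_def by blast

lemma ptimeE:
  assumes "ptime e F"
  obtains p T where "poly_bounded e T"
    "\<And>d x s. s d = e x \<Longrightarrow>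
      \<exists>n s'. exec (p d) s n s' \<and> n \<le> T x \<and> s' d = F x \<and> (\<forall>v<d. s' v = s v)"
proof -
  obtain p T where T: "poly_bounded e T" and
    p: "\<And>x s. s 0 = e x \<Longrightarrow> \<exists>n s'. exec p s n s' \<and> n \<le> T x \<and> s' 0 = F x"
    using assms unfolding ptime_def by blast
  show ?thesis
  proof (rule that[OF T, of "\<lambda>d. rename (\<lambda>v. v + d) p"])
    fix d x and s :: store
    assume "s d = e x"
    then obtain n t where "exec p (\<lambda>v. s (v + d)) n t" "n \<le> T x" "t 0 = F x"
      using p[of "\<lambda>v. s (v + d)" x] by auto
    then show "\<exists>n s'. exec (rename (\<lambda>v. v + d) p) s n s' \<and> n \<le> T x \<and> s' d = F x \<and>
        (\<forall>v<d. s' v = s v)"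
      using exec_shift[of p s d n t] by auto
  qed
qed

lemma ptime_id [intro]: "ptime e e"
proof (rule ptimeI[of _ _ "\<lambda>_. 1" Skip])
  fix x and s :: store assume "s 0 = e x"
  then show "\<exists>n s'. exec Skip s n s' \<and> n \<le> 1 \<and> s' 0 = e x"
    using exec.Skip[of s] by blast
qed auto

text \<open>Plain sequencing is enough because the second program may start in a store with
  arbitrary leftovers. Its time is bounded in the size of the intermediate value, and the size bound
  in \<open>ptime\<close> turns this into a bound in the original input.\<close>

lemma ptime_comp:
  assumes "ptime e' G" "ptime e (\<lambda>x. e' (f x))"
  shows "ptime e (\<lambda>x. G (f x))"
proof -
  obtain p T where T: "poly_bounded e' T" and
    p: "\<And>d x s. s d = e' x \<Longrightarrow>
      \<exists>n s'. exec (p d) s n s' \<and> n \<le> T x \<and> s' d = G x \<and> (\<forall>v<d. s' v = s v)"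
    by (rule ptimeE[OF assms(1)]) blast
  obtain q U where U: "poly_bounded e U" and
    q: "\<And>d x s. s d = e x \<Longrightarrow>
      \<exists>n s'. exec (q d) s n s' \<and> n \<le> U x \<and> s' d = e' (f x) \<and> (\<forall>v<d. s' v = s v)"
    by (rule ptimeE[OF assms(2)]) blast
  show ?thesis
  proof (rule ptimeI[where T = "\<lambda>x. U x + T (f x)" and p = "Seq (q 0) (p 0)"])
    show "poly_bounded e (\<lambda>x. enc_length (G (f x)))"
      using poly_bounded_comp[OF ptime_size[OF assms(1)] ptime_size[OF assms(2)]] .
    show "poly_bounded e (\<lambda>x. U x + T (f x))"
      using U poly_bounded_comp[OF T ptime_size[OF assms(2)]] by auto
    fix x and s :: store assume "s 0 = e x"
    then obtain n u where n: "exec (q 0) s n u" "n \<le> U x" "u 0 = e' (f x)" using q by blast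
    then obtain m w where m: "exec (p 0) u m w" "m \<le> T (f x)" "w 0 = G (f x)" using p by blast
    have "exec (Seq (q 0) (p 0)) s (n + m) w" using n(1) m(1) by (rule exec.Seq)
    moreover have "n + m \<le> U x + T (f x)" using n(2) m(2) by simp
    ultimately show "\<exists>n s'. exec (Seq (q 0) (p 0)) s n s' \<and> n \<le> U x + T (f x) \<and> s' 0 = G (f x)"
      using m(3) by blast
  qed
qed

lemma ptime_Leaf: "ptime e (\<lambda>_. Leaf)"
proof (rule ptimeI[of _ _ "\<lambda>_. 1" "SetLeaf 0"])
  fix x and s :: store
  show "\<exists>n s'. exec (SetLeaf 0) s n s' \<and> n \<le> 1 \<and> s' 0 = Leaf"
    using exec.SetLeaf[of 0 s] by fastforce
qed auto

lemma ptime_Pair: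
  assumes "ptime e F" "ptime e G"
  shows "ptime e (\<lambda>x. Pair (F x) (G x))"
proof -
  obtain p T where T: "poly_bounded e T" and
    p: "\<And>d x s. s d = e x \<Longrightarrow>
      \<exists>n s'. exec (p d) s n s' \<and> n \<le> T x \<and> s' d = F x \<and> (\<forall>v<d. s' v = s v)"
    by (rule ptimeE[OF assms(1)]) blast
  obtain q U where U: "poly_bounded e U" and
    q: "\<And>d x s. s d = e x \<Longrightarrow>
      \<exists>n s'. exec (q d) s n s' \<and> n \<le> U x \<and> s' d = G x \<and> (\<forall>v<d. s' v = s v)"
    by (rule ptimeE[OF assms(2)]) blast
  let ?c = "Seq (Copy 1 0) (Seq (p 1) (Seq (Copy 2 0) (Seq (q 2) (SetPair 0 1 2))))"
  show ?thesis
  proof (rule ptimeI[where T = "\<lambda>x. T x + U x + 3" and p = ?c])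
    show "poly_bounded e (\<lambda>x. enc_length (Pair (F x) (G x)))"
      using poly_bounded_add[OF poly_bounded_add[OF poly_bounded_const[of e 1]
        ptime_size[OF assms(1)]] ptime_size[OF assms(2)]] by simp
    show "poly_bounded e (\<lambda>x. T x + U x + 3)" by (intro poly_bounded_intros T U)
    fix x and s :: store assume s: "s 0 = e x"
    let ?s1 = "s(1 := s 0)"
    obtain n u where n: "exec (p 1) ?s1 n u" "n \<le> T x" "u 1 = F x" "u 0 = s 0"
      using p[of ?s1 1 x] s by auto
    let ?u1 = "u(2 := u 0)"
    obtain m w where m: "exec (q 2) ?u1 m w" "m \<le> U x" "w 2 = G x" "w 1 = u 1"
      using q[of ?u1 2 x] s n by auto
    have "exec ?c s (1 + (n + (1 + (m + 1)))) (w(0 := Pair (w 1) (w 2)))"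
      by (rule exec.Seq exec.Copy exec.SetPair n(1) m(1))+
    moreover have "1 + (n + (1 + (m + 1))) \<le> T x + U x + 3" using n(2) m(2) by simp
    moreover have "(w(0 := Pair (w 1) (w 2))) 0 = Pair (F x) (G x)" using n(3) m(3,4) by simp
    ultimately show "\<exists>n s'. exec ?c s n s' \<and> n \<le> T x + U x + 3 \<and> s' 0 = Pair (F x) (G x)"
      by blast
  qed
qed

lemma ptime_const: "ptime e (\<lambda>_. d)"
  by (induction d) (auto intro: ptime_Leaf ptime_Pair)

lemma enc_length_hd_data: "enc_length (hd_data d) \<le> enc_length d"
  by (cases d) auto

lemma enc_length_tl_data: "enc_length (tl_data d) \<le> enc_length d"
  by (cases d) auto

lemma ptime_hd_data: "ptime e F \<Longrightarrow> ptime e (\<lambda>x. hd_data (F x))"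
proof (rule ptime_comp[of "\<lambda>d. d" hd_data])
  show "ptime (\<lambda>d. d) hd_data"
  proof (rule ptimeI[of _ _ "\<lambda>_. 1" "SetHd 0 0"])
    show "poly_bounded (\<lambda>d. d) (\<lambda>x. enc_length (hd_data x))"
      by (rule poly_bounded_mono[OF poly_bounded_enc_length]) (rule enc_length_hd_data)
    fix x and s :: store assume "s 0 = x"
    then show "\<exists>n s'. exec (SetHd 0 0) s n s' \<and> n \<le> 1 \<and> s' 0 = hd_data x"
      using exec.SetHd[of 0 0 s] by fastforce
  qed auto
qed

lemma ptime_tl_data: "ptime e F \<Longrightarrow> ptime e (\<lambda>x. tl_data (F x))"
proof (rule ptime_comp[of "\<lambda>d. d" tl_data])
  show "ptime (\<lambda>d. d) tl_data"
  proof (rule ptimeI[of _ _ "\<lambda>_. 1" "SetTl 0 0"])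
    show "poly_bounded (\<lambda>d. d) (\<lambda>x. enc_length (tl_data x))"
      by (rule poly_bounded_mono[OF poly_bounded_enc_length]) (rule enc_length_tl_data)
    fix x and s :: store assume "s 0 = x"
    then show "\<exists>n s'. exec (SetTl 0 0) s n s' \<and> n \<le> 1 \<and> s' 0 = tl_data x"
      using exec.SetTl[of 0 0 s] by fastforce
  qed auto
qed

lemma ptime_if_Leaf:
  assumes "ptime e B" "ptime e F" "ptime e G"
  shows "ptime e (\<lambda>x. if B x = Leaf then G x else F x)"
proof -
  obtain b S where S: "poly_bounded e S" and
    b: "\<And>d x s. s d = e x \<Longrightarrow>
      \<exists>n s'. exec (b d) s n s' \<and> n \<le> S x \<and> s' d = B x \<and> (\<forall>v<d. s' v = s v)"
    by (rule ptimeE[OF assms(1)]) blast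
  obtain p T where T: "poly_bounded e T" and
    p: "\<And>d x s. s d = e x \<Longrightarrow>
      \<exists>n s'. exec (p d) s n s' \<and> n \<le> T x \<and> s' d = F x \<and> (\<forall>v<d. s' v = s v)"
    by (rule ptimeE[OF assms(2)]) blast
  obtain q U where U: "poly_bounded e U" and
    q: "\<And>d x s. s d = e x \<Longrightarrow>
      \<exists>n s'. exec (q d) s n s' \<and> n \<le> U x \<and> s' d = G x \<and> (\<forall>v<d. s' v = s v)"
    by (rule ptimeE[OF assms(3)]) blast
  let ?c = "Seq (Copy 1 0) (Seq (b 1) (If 1 (p 0) (q 0)))"
  let ?H = "\<lambda>x. if B x = Leaf then G x else F x"
  show ?thesis
  proof (rule ptimeI[where T = "\<lambda>x. S x + T x + U x + 2" and p = ?c])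
    show "poly_bounded e (\<lambda>x. enc_length (?H x))"
      by (rule poly_bounded_mono[OF poly_bounded_add[OF ptime_size[OF assms(2)]
        ptime_size[OF assms(3)]]]) auto
    show "poly_bounded e (\<lambda>x. S x + T x + U x + 2)" by (intro poly_bounded_intros S T U)
    fix x and s :: store assume s: "s 0 = e x"
    let ?s1 = "s(1 := s 0)"
    obtain n u where n: "exec (b 1) ?s1 n u" "n \<le> S x" "u 1 = B x" "u 0 = s 0"
      using b[of ?s1 1 x] s by auto
    have "\<exists>m w. exec (If 1 (p 0) (q 0)) u (1 + m) w \<and> m \<le> T x + U x \<and> w 0 = ?H x"
    proof (cases "B x = Leaf")
      case True
      obtain m w where "exec (q 0) u m w" "m \<le> U x" "w 0 = G x"
        using q[of u 0 x] n s by auto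
      then show ?thesis using True n exec.IfFalse[of u 1 "q 0" m w "p 0"]
        by (intro exI[of _ m] exI[of _ w]) auto
    next
      case False
      obtain m w where "exec (p 0) u m w" "m \<le> T x" "w 0 = F x"
        using p[of u 0 x] n s by auto
      then show ?thesis using False n exec.IfTrue[of u 1 "p 0" m w "q 0"]
        by (intro exI[of _ m] exI[of _ w]) auto
    qed
    then obtain m w where m: "exec (If 1 (p 0) (q 0)) u (1 + m) w" "m \<le> T x + U x" "w 0 = ?H x"
      by blast
    have "exec ?c s (1 + (n + (1 + m))) w"
      by (rule exec.Seq exec.Copy n(1) m(1))+
    then show "\<exists>n s'. exec ?c s n s' \<and> n \<le> S x + T x + U x + 2 \<and> s' 0 = ?H x"
      using n m by (intro exI[of _ "1 + (n + (1 + m))"] exI[of _ w]) auto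
  qed
qed

section \<open>Polynomial-time functions on HOL types\<close>

definition enc_prod :: "('a \<Rightarrow> data) \<Rightarrow> ('b \<Rightarrow> data) \<Rightarrow> 'a \<times> 'b \<Rightarrow> data" (infixr "\<otimes>" 70) where
  "(e \<otimes> e') = (\<lambda>(x, y). Pair (e x) (e' y))"

lemma enc_prod_simp [simp]: "(e \<otimes> e') (x, y) = Pair (e x) (e' y)"
  by (simp add: enc_prod_def)

text \<open>With functions treated through their encodings, the closure rules below work like typing
  rules and can be applied backwards from the shape of a term.\<close>

definition polytime :: "('a \<Rightarrow> data) \<Rightarrow> ('b \<Rightarrow> data) \<Rightarrow> ('a \<Rightarrow> 'b) \<Rightarrow> bool" where
  "polytime e e' f \<longleftrightarrow> ptime e (\<lambda>x. e' (f x))"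

lemma polytime_size: "polytime e e' f \<Longrightarrow> poly_bounded e (\<lambda>x. enc_length (e' (f x)))"
  unfolding polytime_def by (rule ptime_size)

lemma polytime_comp: "polytime e' e'' g \<Longrightarrow> polytime e e' f \<Longrightarrow> polytime e e'' (\<lambda>x. g (f x))"
  unfolding polytime_def by (rule ptime_comp)

lemma polytime_id: "polytime e e (\<lambda>x. x)"
  unfolding polytime_def by (rule ptime_id)

lemma polytime_const: "polytime e e' (\<lambda>_. c)"
  unfolding polytime_def by (rule ptime_const)

lemma polytime_prod:
  "polytime e ea f \<Longrightarrow> polytime e eb g \<Longrightarrow> polytime e (ea \<otimes> eb) (\<lambda>x. (f x, g x))"
  unfolding polytime_def by (simp add: ptime_Pair)

lemma polytime_fst: "polytime e (ea \<otimes> eb) f \<Longrightarrow> polytime e ea (\<lambda>x. fst (f x))"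
  using ptime_hd_data[of e "\<lambda>x. (ea \<otimes> eb) (f x)"]
  by (simp add: polytime_def enc_prod_def split_beta)

lemma polytime_snd: "polytime e (ea \<otimes> eb) f \<Longrightarrow> polytime e eb (\<lambda>x. snd (f x))"
  using ptime_tl_data[of e "\<lambda>x. (ea \<otimes> eb) (f x)"]
  by (simp add: polytime_def enc_prod_def split_beta)

lemma polytime_if:
  assumes "polytime e enc_bool b" "polytime e ea f" "polytime e ea g"
  shows "polytime e ea (\<lambda>x. if b x then f x else g x)"
proof -
  have "(\<lambda>x. ea (if b x then f x else g x)) =
      (\<lambda>x. if enc_bool (b x) = Leaf then ea (g x) else ea (f x))"
    by (auto simp: fun_eq_iff)
  then show ?thesis using ptime_if_Leaf[OF assms[unfolded polytime_def]] by (simp add: polytime_def)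
qed

lemma polytime_Cons:
  "polytime e ea f \<Longrightarrow> polytime e (enc_list ea) g \<Longrightarrow> polytime e (enc_list ea) (\<lambda>x. f x # g x)"
  unfolding polytime_def by (simp add: ptime_Pair)

lemma polytime_tl:
  assumes "polytime e (enc_list ea) f"
  shows "polytime e (enc_list ea) (\<lambda>x. tl (f x))"
proof -
  have "enc_list ea (tl l) = tl_data (enc_list ea l)" for l by (cases l) auto
  then show ?thesis using assms unfolding polytime_def by (simp add: ptime_tl_data)
qed

lemma polytime_is_Nil:
  assumes "polytime e (enc_list ea) f"
  shows "polytime e enc_bool (\<lambda>x. f x = [])"
proof -
  have "enc_bool (l = []) = (if enc_list ea l = Leaf then enc_bool True else enc_bool False)" for l
    by (cases l) auto
  then show ?thesis unfolding polytime_def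
    by (simp only:) (rule ptime_if_Leaf[OF assms[unfolded polytime_def] ptime_const ptime_const])
qed

text \<open>The step also sees the tail that remains: its length acts as a position counter, and the
  tail itself supplies the later elements when subsequences are enumerated.\<close>

fun tfold :: "('b \<Rightarrow> 'a \<Rightarrow> 'a list \<Rightarrow> 'b) \<Rightarrow> 'b \<Rightarrow> 'a list \<Rightarrow> 'b" where
  "tfold g acc [] = acc"
| "tfold g acc (a # l) = tfold g (g acc a l) l"

lemma length_le_enc_length: "length l \<le> enc_length (enc_list e l)"
  by (induction l) (use enc_length_pos in auto)

text \<open>Polynomial steps alone do not suffice, as repeated doubling of the accumulator would
  make it exponential. The invariant keeps every accumulator below one polynomial \<open>B\<close>,
  and then all iterations obey the same time bound.\<close>

lemma polytime_tfold_inv: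
  fixes e :: "'x \<Rightarrow> data" and ea :: "'a \<Rightarrow> data" and eb :: "'b \<Rightarrow> data"
  assumes l: "polytime e (enc_list ea) l"
    and init: "polytime e eb init"
    and step: "polytime (e \<otimes> eb \<otimes> ea \<otimes> enc_list ea) eb
      (\<lambda>p. g (fst p) (fst (snd p)) (fst (snd (snd p))) (snd (snd (snd p))))"
    and inv0: "\<And>x. Inv x (init x) (l x)"
    and inv1: "\<And>x acc a k. Inv x acc (a # k) \<Longrightarrow> Inv x (g x acc a k) k"
    and B: "poly_bounded e B" "\<And>x acc k. Inv x acc k \<Longrightarrow> enc_length (eb acc) \<le> B x"
  shows "polytime e eb (\<lambda>x. tfold (g x) (init x) (l x))"
proof -
  obtain p T where T: "poly_bounded e T" and
    p: "\<And>d x s. s d = e x \<Longrightarrow>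
      \<exists>n s'. exec (p d) s n s' \<and> n \<le> T x \<and> s' d = enc_list ea (l x) \<and> (\<forall>v<d. s' v = s v)"
    by (rule ptimeE[OF l[unfolded polytime_def]]) blast
  obtain q U where U: "poly_bounded e U" and
    q: "\<And>d x s. s d = e x \<Longrightarrow>
      \<exists>n s'. exec (q d) s n s' \<and> n \<le> U x \<and> s' d = eb (init x) \<and> (\<forall>v<d. s' v = s v)"
    by (rule ptimeE[OF init[unfolded polytime_def]]) blast
  obtain r R where R: "poly_bounded (e \<otimes> eb \<otimes> ea \<otimes> enc_list ea) R" and
    r: "\<And>d y s. s d = (e \<otimes> eb \<otimes> ea \<otimes> enc_list ea) y \<Longrightarrow>
      \<exists>n s'. exec (r d) s n s' \<and> n \<le> R y \<and>
        s' d = eb (g (fst y) (fst (snd y)) (fst (snd (snd y))) (snd (snd (snd y)))) \<and>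
        (\<forall>v<d. s' v = s v)"
    by (rule ptimeE[OF step[unfolded polytime_def]]) blast
  obtain c where c: "\<And>y. R y \<le> c * enc_length ((e \<otimes> eb \<otimes> ea \<otimes> enc_list ea) y) ^ c"
    using R unfolding poly_bounded_def by blast
  define N where "N x = enc_length (enc_list ea (l x))" for x
  have N: "poly_bounded e N" using polytime_size[OF l] by (simp add: N_def[abs_def])
  \<comment> \<open>The argument of a step consists of two pair nodes together with
    \<open>x\<close>, the accumulator and \<open>a # k\<close>; this accounts for the sum in
    brackets.\<close>
  define S where "S x = c * (2 + enc_length (e x) + B x + N x) ^ c" for x
  have S: "poly_bounded e S"
    unfolding S_def by (intro poly_bounded_intros N B(1))
  \<comment> \<open>Register 0 keeps the input, 1 the remaining list, 2 the accumulator. Since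
    \<open>a # k\<close> is encoded as the pair of \<open>a\<close> and \<open>k\<close>, the list
    in register 1 already is the last component of the argument.\<close>
  let ?body = "Seq (SetPair 3 2 1) (Seq (SetPair 3 0 3) (Seq (r 3) (Seq (Copy 2 3) (SetTl 1 1))))"
  let ?loop = "While 1 ?body"
  have loop: "\<exists>n s'. exec ?loop s n s' \<and> n \<le> 1 + length k * (5 + S x) \<and>
      s' 2 = eb (tfold (g x) acc k)"
    if "s 0 = e x" "s 1 = enc_list ea k" "s 2 = eb acc" "Inv x acc k"
      "enc_length (enc_list ea k) \<le> N x" for x k acc s
    using that
  proof (induction k arbitrary: acc s)
    case Nil
    then show ?case using exec.WhileFalse[of s 1 ?body] by fastforce
  next
    case (Cons a k)
    let ?y = "(x, acc, a, k)"
    let ?s1 = "s(3 := Pair (s 2) (s 1))"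
    let ?s2 = "?s1(3 := Pair (?s1 0) (?s1 3))"
    have "?s2 3 = (e \<otimes> eb \<otimes> ea \<otimes> enc_list ea) ?y"
      using Cons.prems by simp
    from r[of ?s2 3 ?y, OF this] obtain n u where n: "exec (r 3) ?s2 n u" "n \<le> R ?y"
      "u 3 = eb (g x acc a k)" "\<forall>v<3. u v = ?s2 v"
      by auto
    let ?u1 = "u(2 := u 3)"
    let ?u2 = "?u1(1 := tl_data (?u1 1))"
    have body: "exec ?body s (1 + (1 + (n + (1 + 1)))) ?u2"
      by (rule exec.Seq exec.SetPair exec.Copy exec.SetTl n(1))+
    have "\<exists>m w. exec ?loop ?u2 m w \<and> m \<le> 1 + length k * (5 + S x) \<and>
        w 2 = eb (tfold (g x) (g x acc a k) k)"
      using Cons.prems n inv1 by (intro Cons.IH) auto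
    then obtain m w where m: "exec ?loop ?u2 m w" "m \<le> 1 + length k * (5 + S x)"
        "w 2 = eb (tfold (g x) (g x acc a k) k)"
      by blast
    have "enc_length ((e \<otimes> eb \<otimes> ea \<otimes> enc_list ea) ?y) \<le> 2 + enc_length (e x) + B x + N x"
      using Cons.prems B(2)[OF Cons.prems(4)] by simp
    then have "R ?y \<le> S x"
      unfolding S_def by (intro order.trans[OF c[of ?y]] mult_left_mono power_mono) auto
    moreover have "s 1 \<noteq> Leaf" using Cons.prems by simp
    ultimately have "exec ?loop s (1 + (1 + (1 + (n + (1 + 1)))) + m) w"
      "1 + (1 + (1 + (n + (1 + 1)))) + m \<le> 1 + length (a # k) * (5 + S x)"
      using exec.WhileTrue[OF _ body m(1)] n(2) m(2) by auto
    then show ?case using m(3) by fastforce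
  qed
  let ?c = "Seq (Copy 1 0) (Seq (p 1) (Seq (Copy 2 0) (Seq (q 2) (Seq ?loop (Copy 0 2)))))"
  let ?F = "\<lambda>x. eb (tfold (g x) (init x) (l x))"
  have inv2: "Inv x (tfold (g x) acc k) []" if "Inv x acc k" for x acc k
    using that by (induction k arbitrary: acc) (auto dest: inv1)
  show ?thesis unfolding polytime_def
  proof (rule ptimeI[where p = ?c and T = "\<lambda>x. T x + U x + 4 + N x * (5 + S x)"])
    show "poly_bounded e (\<lambda>x. enc_length (?F x))"
      by (rule poly_bounded_mono[OF B(1)]) (rule B(2)[OF inv2[OF inv0]])
    show "poly_bounded e (\<lambda>x. T x + U x + 4 + N x * (5 + S x))"
      by (intro poly_bounded_intros T U N S)
    fix x and s :: store assume s: "s 0 = e x"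
    let ?s1 = "s(1 := s 0)"
    obtain n u where n: "exec (p 1) ?s1 n u" "n \<le> T x" "u 1 = enc_list ea (l x)" "u 0 = s 0"
      using p[of ?s1 1 x] s by auto
    let ?u1 = "u(2 := u 0)"
    obtain m w where m: "exec (q 2) ?u1 m w" "m \<le> U x" "w 2 = eb (init x)" "w 1 = u 1" "w 0 = u 0"
      using q[of ?u1 2 x] s n by auto
    obtain j z where j: "exec ?loop w j z" "j \<le> 1 + length (l x) * (5 + S x)" "z 2 = ?F x"
      using loop[of w x "l x" "init x"] m n s inv0 by (auto simp: N_def)
    have "exec ?c s (1 + (n + (1 + (m + (j + 1))))) (z(0 := z 2))"
      by (rule exec.Seq exec.Copy n(1) m(1) j(1))+
    moreover have "length (l x) * (5 + S x) \<le> N x * (5 + S x)"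
      unfolding N_def by (intro mult_right_mono length_le_enc_length) auto
    then have "1 + (n + (1 + (m + (j + 1)))) \<le> T x + U x + 4 + N x * (5 + S x)"
      using n(2) m(2) j(2) by linarith
    moreover have "(z(0 := z 2)) 0 = ?F x" using j(3) by simp
    ultimately show "\<exists>n s'. exec ?c s n s' \<and> n \<le> T x + U x + 4 + N x * (5 + S x) \<and> s' 0 = ?F x"
      by blast
  qed
qed

text \<open>If each step adds at most \<open>D x\<close> to the size, the growth is bounded by the
  length of the list times \<open>D x\<close>; the invariant charges it in advance to the elements
  still to come.\<close>

lemma polytime_tfold:
  fixes e :: "'x \<Rightarrow> data" and ea :: "'a \<Rightarrow> data" and eb :: "'b \<Rightarrow> data"
  assumes l: "polytime e (enc_list ea) l"
    and init: "polytime e eb init"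
    and step: "polytime (e \<otimes> eb \<otimes> ea \<otimes> enc_list ea) eb
      (\<lambda>p. g (fst p) (fst (snd p)) (fst (snd (snd p))) (snd (snd (snd p))))"
    and D: "poly_bounded e D"
      "\<And>x acc a k. enc_length (enc_list ea (a # k)) \<le> enc_length (enc_list ea (l x)) \<Longrightarrow>
        enc_length (eb (g x acc a k)) \<le> enc_length (eb acc) + D x"
  shows "polytime e eb (\<lambda>x. tfold (g x) (init x) (l x))"
proof -
  let ?N = "\<lambda>x. enc_length (enc_list ea (l x))"
  let ?B = "\<lambda>x. enc_length (eb (init x)) + ?N x * D x"
  let ?Inv = "\<lambda>x acc k. enc_length (enc_list ea k) \<le> ?N x \<and>
    enc_length (eb acc) + length k * D x \<le> ?B x"
  show ?thesis
  proof (rule polytime_tfold_inv[OF l init step, where Inv = ?Inv and B = ?B])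
    show "?Inv x (init x) (l x)" for x
      by (simp add: length_le_enc_length)
    show "?Inv x (g x acc a k) k" if "?Inv x acc (a # k)" for x acc a k
      using that D(2)[of a k x acc] by auto
    show "poly_bounded e ?B"
      by (intro poly_bounded_intros polytime_size[OF l] polytime_size[OF init] D(1))
    show "enc_length (eb acc) \<le> ?B x" if "?Inv x acc k" for x acc k
      using that by auto
  qed
qed

section \<open>Basic list and number operations\<close>

lemma polytime_not:
  assumes "polytime e enc_bool b"
  shows "polytime e enc_bool (\<lambda>x. \<not> b x)"
  by (rule back_subst[of "polytime e enc_bool", OF polytime_if[OF assms polytime_const[of _ _ False]
        polytime_const[of _ _ True]]]) auto

lemma polytime_conj:
  assumes "polytime e enc_bool b" "polytime e enc_bool c"
  shows "polytime e enc_bool (\<lambda>x. b x \<and> c x)"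
  by (rule back_subst[of "polytime e enc_bool", OF polytime_if[OF assms polytime_const[of _ _ False]]])
    auto

lemma polytime_disj:
  "polytime e enc_bool b \<Longrightarrow> polytime e enc_bool c \<Longrightarrow> polytime e enc_bool (\<lambda>x. b x \<or> c x)"
  using polytime_not[OF polytime_conj[OF polytime_not polytime_not], of e b c] by simp

lemma polytime_bool_eq:
  assumes "polytime e enc_bool b" "polytime e enc_bool c"
  shows "polytime e enc_bool (\<lambda>x. b x = c x)"
  by (rule back_subst[of "polytime e enc_bool", OF polytime_if[OF assms polytime_not[OF assms(2)]]])
    auto

lemmas polytime_intros = polytime_id polytime_const polytime_prod polytime_fst polytime_snd
  polytime_if polytime_Cons polytime_tl polytime_is_Nil polytime_not polytime_conj polytime_disj
  polytime_bool_eq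

lemma enc_length_append:
  "enc_length (enc_list e (xs @ ys)) < enc_length (enc_list e xs) + enc_length (enc_list e ys)"
  by (induction xs) auto

lemma tfold_Cons: "tfold (\<lambda>acc a _. a # acc) ys xs = rev xs @ ys"
  by (induction xs arbitrary: ys) auto

lemma polytime_tfold_Cons:
  assumes "polytime e (enc_list ea) f" "polytime e (enc_list ea) g"
  shows "polytime e (enc_list ea) (\<lambda>x. rev (f x) @ g x)"
proof -
  have "polytime e (enc_list ea) (\<lambda>x. tfold (\<lambda>acc a _. a # acc) (g x) (f x))"
  proof (rule polytime_tfold[OF assms])
    show "poly_bounded e (\<lambda>x. enc_length (enc_list ea (f x)))"
      using assms(1) by (rule polytime_size)
    show "polytime (e \<otimes> enc_list ea \<otimes> ea \<otimes> enc_list ea) (enc_list ea)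
        (\<lambda>p. fst (snd (snd p)) # fst (snd p))"
      by (rule polytime_intros)+
  qed auto
  then show ?thesis by (simp add: tfold_Cons)
qed

lemma polytime_rev:
  "polytime e (enc_list ea) f \<Longrightarrow> polytime e (enc_list ea) (\<lambda>x. rev (f x))"
  using polytime_tfold_Cons[OF _ polytime_const[of e "enc_list ea" "[]"]] by simp

lemma polytime_append:
  "polytime e (enc_list ea) f \<Longrightarrow> polytime e (enc_list ea) g \<Longrightarrow>
    polytime e (enc_list ea) (\<lambda>x. f x @ g x)"
  using polytime_tfold_Cons[OF polytime_rev, of e ea f g] by simp

text \<open>The prepended list does not depend on the accumulator, so its size is bounded in terms
  of \<open>x\<close> and \<open>l x\<close> alone and the growth is additive.\<close>

lemma polytime_tfold_append:
  assumes l: "polytime e (enc_list ea) l" and init: "polytime e (enc_list eb) init"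
    and G: "polytime (e \<otimes> ea \<otimes> enc_list ea) (enc_list eb)
      (\<lambda>p. G (fst p) (fst (snd p)) (snd (snd p)))"
  shows "polytime e (enc_list eb) (\<lambda>x. tfold (\<lambda>acc a k. G x a k @ acc) (init x) (l x))"
proof -
  obtain c where c: "\<And>p. enc_length (enc_list eb (G (fst p) (fst (snd p)) (snd (snd p))))
      \<le> c * enc_length ((e \<otimes> ea \<otimes> enc_list ea) p) ^ c"
    using polytime_size[OF G] unfolding poly_bounded_def by blast
  let ?N = "\<lambda>x. enc_length (enc_list ea (l x))"
  let ?D = "\<lambda>x. c * (1 + enc_length (e x) + ?N x) ^ c"
  show ?thesis
  proof (rule polytime_tfold[OF l init, where D = ?D])
    show "poly_bounded e ?D"
      by (intro poly_bounded_intros polytime_size[OF l])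
    let ?e = "e \<otimes> enc_list eb \<otimes> ea \<otimes> enc_list ea"
    have "polytime ?e (e \<otimes> ea \<otimes> enc_list ea) (\<lambda>p. (fst p, snd (snd p)))"
      by (rule polytime_intros)+
    from polytime_comp[OF G this]
    have "polytime ?e (enc_list eb) (\<lambda>p. G (fst p) (fst (snd (snd p))) (snd (snd (snd p))))"
      by simp
    from polytime_append[OF this] show "polytime ?e (enc_list eb)
        (\<lambda>p. G (fst p) (fst (snd (snd p))) (snd (snd (snd p))) @ fst (snd p))"
      by this (rule polytime_intros)+
    fix x acc a k
    assume le: "enc_length (enc_list ea (a # k)) \<le> ?N x"
    have "enc_length (enc_list eb (G x a k)) \<le> c * enc_length ((e \<otimes> ea \<otimes> enc_list ea) (x, a, k)) ^ c"
      using c[of "(x, a, k)"] by simp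
    also have "\<dots> \<le> ?D x"
      using le by (intro mult_left_mono power_mono) auto
    finally show "enc_length (enc_list eb (G x a k @ acc)) \<le> enc_length (enc_list eb acc) + ?D x"
      using enc_length_append[of eb "G x a k" acc] by linarith
  qed
qed

lemma tfold_append: "tfold (\<lambda>acc a k. G a k @ acc) ys xs = tfold (\<lambda>acc a k. G a k @ acc) [] xs @ ys"
proof (induction xs arbitrary: ys)
  case (Cons a xs)
  show ?case using Cons[of "G a xs @ ys"] Cons[of "G a xs"] by simp
qed simp

lemma tfold_append_rev: "tfold (\<lambda>acc a k. h a @ acc) [] (rev xs) = concat (map h xs)"
proof -
  have "tfold (\<lambda>acc a k. h a @ acc) ys xs = concat (map h (rev xs)) @ ys" for ys xs
    by (induction xs arbitrary: ys) auto
  then show ?thesis by simp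
qed

text \<open>The fold prepends, so it is run on the reversed list to preserve the order.\<close>

lemma polytime_concat_map:
  assumes "polytime e (enc_list ea) l"
    and "polytime (e \<otimes> ea) (enc_list eb) (\<lambda>p. h (fst p) (snd p))"
  shows "polytime e (enc_list eb) (\<lambda>x. concat (map (h x) (l x)))"
proof -
  have "polytime (e \<otimes> ea \<otimes> enc_list ea) (e \<otimes> ea) (\<lambda>p. (fst p, fst (snd p)))"
    by (rule polytime_intros)+
  from polytime_comp[OF assms(2) this]
  have "polytime (e \<otimes> ea \<otimes> enc_list ea) (enc_list eb) (\<lambda>p. h (fst p) (fst (snd p)))"
    by simp
  from polytime_tfold_append[OF polytime_rev[OF assms(1)] polytime_const[of e _ "[]"] this]
  show ?thesis by (simp add: tfold_append_rev)
qed

lemma polytime_map: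
  assumes "polytime e (enc_list ea) l" "polytime (e \<otimes> ea) eb (\<lambda>p. h (fst p) (snd p))"
  shows "polytime e (enc_list eb) (\<lambda>x. map (h x) (l x))"
proof -
  have "polytime (e \<otimes> ea) (enc_list eb) (\<lambda>p. [h (fst p) (snd p)])"
    by (intro polytime_Cons polytime_const assms(2))
  from polytime_concat_map[OF assms(1) this] show ?thesis by (simp add: concat_map_singleton)
qed

lemma polytime_filter:
  assumes "polytime e (enc_list ea) l" "polytime (e \<otimes> ea) enc_bool (\<lambda>p. P (fst p) (snd p))"
  shows "polytime e (enc_list ea) (\<lambda>x. filter (P x) (l x))"
proof -
  have "polytime (e \<otimes> ea) (enc_list ea) (\<lambda>p. if P (fst p) (snd p) then [snd p] else [])"
    by (rule polytime_if[OF assms(2)]) (rule polytime_intros)+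
  from polytime_concat_map[OF assms(1) this]
  have "polytime e (enc_list ea) (\<lambda>x. concat (map (\<lambda>a. if P x a then [a] else []) (l x)))"
    by simp
  moreover have "concat (map (\<lambda>a. if Q a then [a] else []) xs) = filter Q xs" for Q and xs :: "'b list"
    by (induction xs) auto
  ultimately show ?thesis by simp
qed

lemma polytime_Bex:
  assumes "polytime e (enc_list ea) l" "polytime (e \<otimes> ea) enc_bool (\<lambda>p. P (fst p) (snd p))"
  shows "polytime e enc_bool (\<lambda>x. \<exists>a\<in>set (l x). P x a)"
  using polytime_not[OF polytime_is_Nil[OF polytime_filter[OF assms]]]
  by (simp add: filter_empty_conv)

lemma polytime_Ball:
  assumes "polytime e (enc_list ea) l" "polytime (e \<otimes> ea) enc_bool (\<lambda>p. P (fst p) (snd p))"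
  shows "polytime e enc_bool (\<lambda>x. \<forall>a\<in>set (l x). P x a)"
  using polytime_not[OF polytime_Bex[OF assms(1) polytime_not[OF assms(2)]]] by simp

lemma polytime_concat:
  "polytime e (enc_list (enc_list ea)) l \<Longrightarrow> polytime e (enc_list ea) (\<lambda>x. concat (l x))"
  using polytime_concat_map[of e "enc_list ea" l ea "\<lambda>_ a. a", OF _ polytime_snd[OF polytime_id]]
  by simp

lemma polytime_drop:
  "polytime e (enc_list ea) f \<Longrightarrow> polytime e (enc_list ea) (\<lambda>x. drop r (f x))"
proof (induction r arbitrary: f)
  case (Suc r)
  show ?case using Suc.IH[OF polytime_tl[OF Suc.prems]] by (simp add: drop_Suc)
qed simp

section \<open>Arithmetic on binary numbers\<close>

fun bits :: "nat \<Rightarrow> bool list" where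
  "bits n = (if n = 0 then [] else odd n # bits (n div 2))"

declare bits.simps [simp del]

text \<open>Numbers and bit lists share their encoding, so arithmetic becomes folding over lists of
  bits.\<close>

lemma enc_nat_eq_bits: "enc_nat n = enc_list enc_bool (bits n)"
  by (induction n rule: bits.induct) (subst enc_nat.simps, subst bits.simps, auto)

lemma polytime_bits_iff: "polytime e enc_nat f \<longleftrightarrow> polytime e (enc_list enc_bool) (\<lambda>x. bits (f x))"
  by (simp add: polytime_def enc_nat_eq_bits)

lemma bits_inject: "bits m = bits n \<longleftrightarrow> m = n"
proof (induction m arbitrary: n rule: bits.induct)
  case (1 m)
  show ?case
  proof (cases "m = 0 \<or> n = 0")
    case True
    then show ?thesis by (subst (1 2) bits.simps) auto
  next
    case False
    then have "bits m = bits n \<longleftrightarrow> odd m = odd n \<and> m div 2 = n div 2"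
      using 1[of "n div 2"] by (subst (1 2) bits.simps) auto
    also have "\<dots> \<longleftrightarrow> m = n" by (metis bit_eq_rec)
    finally show ?thesis .
  qed
qed

text \<open>The head of \<open>Leaf\<close> is \<open>Leaf\<close>, the code of
  \<open>False\<close>, so reading past the end of a list gives \<open>False\<close> without a case
  distinction.\<close>

lemma polytime_hd_bool:
  assumes "polytime e (enc_list enc_bool) f"
  shows "polytime e enc_bool (\<lambda>x. f x \<noteq> [] \<and> hd (f x))"
proof -
  have "enc_bool (l \<noteq> [] \<and> hd l) = hd_data (enc_list enc_bool l)" for l by (cases l) auto
  then show ?thesis using assms by (simp add: polytime_def ptime_hd_data)
qed

lemma enc_length_bool: "enc_length (enc_bool b) \<le> 3"
  by (cases b) auto

lemma enc_length_tl: "enc_length (enc_list e (tl xs)) \<le> enc_length (enc_list e xs)"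
  by (cases xs) auto

text \<open>The fold recurses on one list and consumes the other in the accumulator. The flag
  records that all entries agreed and the other list did not run out early; a final emptiness test
  excludes that it is longer.\<close>

lemma polytime_bool_list_eq:
  assumes "polytime e (enc_list enc_bool) f" "polytime e (enc_list enc_bool) g"
  shows "polytime e enc_bool (\<lambda>x. f x = g x)"
proof -
  define step where "step = (\<lambda>acc a (k :: bool list).
    (tl (fst acc), snd acc \<and> fst acc \<noteq> [] \<and> ((fst acc \<noteq> [] \<and> hd (fst acc)) = a)))"
  let ?r = "\<lambda>x. tfold step (g x, True) (f x)"
  have "polytime e (enc_list enc_bool \<otimes> enc_bool) ?r"
  proof (rule polytime_tfold[OF assms(1)])
    show "polytime e (enc_list enc_bool \<otimes> enc_bool) (\<lambda>x. (g x, True))"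
      by (intro polytime_prod polytime_const assms)
    show "polytime (e \<otimes> (enc_list enc_bool \<otimes> enc_bool) \<otimes> enc_bool \<otimes> enc_list enc_bool)
      (enc_list enc_bool \<otimes> enc_bool)
      (\<lambda>p. step (fst (snd p)) (fst (snd (snd p))) (snd (snd (snd p))))"
      unfolding step_def
      by (intro polytime_prod polytime_conj polytime_bool_eq polytime_hd_bool polytime_tl
          polytime_not polytime_is_Nil) (rule polytime_intros)+
    show "poly_bounded e (\<lambda>_. 2)" by auto
    show "enc_length ((enc_list enc_bool \<otimes> enc_bool) (step acc a k))
      \<le> enc_length ((enc_list enc_bool \<otimes> enc_bool) acc) + 2" for acc a k
      using enc_length_tl[of enc_bool "fst acc"]
        enc_length_bool[of "fst acc \<noteq> [] \<and> ((fst acc \<noteq> [] \<and> hd (fst acc)) = a)"]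
        enc_length_pos[of "enc_bool (snd acc)"]
      by (cases acc; cases "snd acc") (auto simp: step_def)
  qed
  then have "polytime e enc_bool (\<lambda>x. snd (?r x) \<and> fst (?r x) = [])"
    by (intro polytime_conj polytime_is_Nil polytime_fst polytime_snd)
  moreover have "snd (tfold step (ys, b) xs) \<and> fst (tfold step (ys, b) xs) = [] \<longleftrightarrow> b \<and> xs = ys"
    for ys xs b
  proof (induction xs arbitrary: ys b)
    case (Cons a xs)
    then show ?case by (cases ys) (auto simp: step_def)
  qed auto
  ultimately show ?thesis by simp
qed

lemma polytime_nat_eq:
  "polytime e enc_nat f \<Longrightarrow> polytime e enc_nat g \<Longrightarrow> polytime e enc_bool (\<lambda>x. f x = g x)"
  using polytime_bool_list_eq[of e "\<lambda>x. bits (f x)" "\<lambda>x. bits (g x)"]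
  by (simp add: polytime_bits_iff bits_inject)

lemma polytime_member:
  assumes "polytime e enc_nat f" "polytime e (enc_list enc_nat) g"
  shows "polytime e enc_bool (\<lambda>x. f x \<in> set (g x))"
proof -
  have "polytime (e \<otimes> enc_nat) enc_bool (\<lambda>p. f (fst p) = snd p)"
    by (intro polytime_nat_eq polytime_comp[OF assms(1)]) (rule polytime_intros)+
  from polytime_Bex[OF assms(2) this] show ?thesis by simp
qed

text \<open>Ripple-carry increment: the accumulator holds the carry, initially \<open>True\<close>,
  and the output bits in reverse.\<close>

lemma polytime_Suc:
  assumes "polytime e enc_nat f"
  shows "polytime e enc_nat (\<lambda>x. Suc (f x))"
proof -
  define step where "step = (\<lambda>acc a (k :: bool list). (fst acc \<and> a, (\<not> a = fst acc) # snd acc))"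
  let ?r = "\<lambda>x. tfold step (True, []) (bits (f x))"
  have "polytime e (enc_bool \<otimes> enc_list enc_bool) ?r"
  proof (rule polytime_tfold[where ea = enc_bool])
    show "polytime e (enc_list enc_bool) (\<lambda>x. bits (f x))"
      using assms by (simp add: polytime_bits_iff)
    show "polytime e (enc_bool \<otimes> enc_list enc_bool) (\<lambda>x. (True, []))"
      by (rule polytime_const)
    show "polytime (e \<otimes> (enc_bool \<otimes> enc_list enc_bool) \<otimes> enc_bool \<otimes> enc_list enc_bool)
      (enc_bool \<otimes> enc_list enc_bool)
      (\<lambda>p. step (fst (snd p)) (fst (snd (snd p))) (snd (snd (snd p))))"
      unfolding step_def
      by (intro polytime_prod polytime_conj polytime_not polytime_bool_eq polytime_Cons)
        (rule polytime_intros)+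
    show "poly_bounded e (\<lambda>_. 6)" by auto
    show "enc_length ((enc_bool \<otimes> enc_list enc_bool) (step acc a k))
      \<le> enc_length ((enc_bool \<otimes> enc_list enc_bool) acc) + 6" for acc a k
      by (cases acc; cases a; cases "fst acc") (auto simp: step_def)
  qed
  \<comment> \<open>A carry left at the end becomes the new most significant bit.\<close>
  then have "polytime e (enc_list enc_bool) (\<lambda>x. rev (if fst (?r x) then True # snd (?r x) else snd (?r x)))"
    by (intro polytime_rev polytime_if polytime_Cons polytime_const polytime_fst polytime_snd)
  moreover define finish where "finish = (\<lambda>p. rev (if fst p then True # snd p else snd p))"
  ultimately have "polytime e (enc_list enc_bool) (\<lambda>x. finish (?r x))"
    by simp
  moreover have "finish (tfold step (c, out) (bits n)) = rev out @ bits (n + of_bool c)" for c out n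
  proof (induction n arbitrary: c out rule: bits.induct)
    case (1 n)
    show ?case
    proof (cases "n = 0")
      case True
      then show ?thesis by (auto simp: finish_def bits.simps[of 0] bits.simps[of "Suc 0"])
    next
      case False
      have bits: "bits (n + of_bool c) = (\<not> odd n = c) # bits (n div 2 + of_bool (c \<and> odd n))"
        using False by (subst bits.simps) auto
      have "bits n = odd n # bits (n div 2)"
        using False by (subst bits.simps) simp
      then have "finish (tfold step (c, out) (bits n)) =
          finish (tfold step (c \<and> odd n, (\<not> odd n = c) # out) (bits (n div 2)))"
        by (simp add: step_def)
      also have "\<dots> = rev ((\<not> odd n = c) # out) @ bits (n div 2 + of_bool (c \<and> odd n))"
        by (rule 1[OF False])
      finally show ?thesis unfolding bits by simp
    qed
  qed
  from this[of True "[]"] have "finish (tfold step (True, []) (bits n)) = bits (Suc n)" for n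
    by simp
  ultimately show ?thesis by (simp add: polytime_bits_iff)
qed

lemma enc_length_Suc: "enc_length (enc_nat (Suc n)) \<le> enc_length (enc_nat n) + 4"
proof (induction n rule: bits.induct)
  case (1 n)
  show ?case
  proof (cases "n = 0")
    case True
    then show ?thesis by (simp add: enc_nat.simps[of 0] enc_nat.simps[of "Suc 0"])
  next
    case False
    then show ?thesis using 1 
      by (subst (1 2) enc_nat.simps) (cases "odd n"; auto)
  qed
qed

lemma enc_length_nat: "enc_length (enc_nat n) \<le> 4 * n + 1"
proof (induction n)
  case (Suc n)
  then show ?case using enc_length_Suc[of n] by simp
qed (simp add: enc_nat.simps[of 0])

lemma polytime_length:
  assumes "polytime e (enc_list ea) f"
  shows "polytime e enc_nat (\<lambda>x. length (f x))"
proof -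
  have "polytime e enc_nat (\<lambda>x. tfold (\<lambda>acc _ _. Suc acc) 0 (f x))"
    by (rule polytime_tfold[OF assms, where D = "\<lambda>_. 4"])
      ((rule enc_length_Suc polytime_Suc poly_bounded_const polytime_intros)+)
  moreover have "tfold (\<lambda>acc _ _. Suc acc) n xs = n + length xs" for n and xs :: "'b list"
    by (induction xs arbitrary: n) auto
  ultimately show ?thesis by simp
qed

section \<open>The reduction\<close>

lemma tfold_upt: "tfold (\<lambda>acc _ k. length k # acc) ys xs = [0..<length xs] @ ys"
  by (induction xs arbitrary: ys) auto

text \<open>The tails have lengths \<open>length (f x) - 1\<close> down to 0, and prepending these
  lengths yields the increasing enumeration.\<close>

lemma polytime_upt_length:
  assumes "polytime e (enc_list ea) f"
  shows "polytime e (enc_list enc_nat) (\<lambda>x. [0..<length (f x)])"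
proof -
  have "polytime e (enc_list enc_nat) (\<lambda>x. tfold (\<lambda>acc _ k. [length k] @ acc) [] (f x))"
    by (rule polytime_tfold_append[OF assms]) (rule polytime_length polytime_intros)+
  then show ?thesis by (simp add: tfold_upt)
qed

text \<open>A list of length \<open>n\<close> for a number \<open>n\<close> given in binary; it is the empty list if \<open>n\<close> is not smaller than
  the length of the bounding list.\<close>

definition suffix_of_length :: "nat \<Rightarrow> 'a list \<Rightarrow> 'a list" where
  "suffix_of_length n xs = tfold (\<lambda>acc _ k. (if length k = n then k else []) @ acc) [] xs"

lemma length_suffix_of_length:
  "length (suffix_of_length n xs) = (if n < length xs then n else 0)"
proof -
  have "length (tfold (\<lambda>acc _ k. (if length k = n then k else []) @ acc) ys xs) =
      (if n < length xs then n else 0) + length ys" for ys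
    by (induction xs arbitrary: ys) auto
  then show ?thesis by (simp add: suffix_of_length_def)
qed

lemma polytime_suffix_of_length:
  assumes "polytime e enc_nat n" "polytime e (enc_list ea) f"
  shows "polytime e (enc_list ea) (\<lambda>x. suffix_of_length (n x) (f x))"
  unfolding suffix_of_length_def
  by (rule polytime_tfold_append[OF assms(2)])
    (rule polytime_length polytime_nat_eq polytime_comp[OF assms(1)] polytime_intros)+

text \<open>\<open>drop r xs = []\<close> tests for at most \<open>r\<close> remaining elements. The
  idle case is there because the fold makes one step per list element, which can exceed the number
  of blocks.\<close>

definition split_step :: "nat \<Rightarrow> 'a list \<times> bool list \<Rightarrow> 'a list \<times> bool list" where
  "split_step r acc = (if fst acc = [] then acc
    else if drop r (fst acc) = [] then (tl (fst acc), False # snd acc)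
    else (drop (Suc r) (fst acc), True # snd acc))"

text \<open>Splits the length \<open>t\<close> of a list into \<open>t div (r + 1)\<close> blocks of size \<open>r + 1\<close> (\<open>True\<close>) and
  \<open>t mod (r + 1)\<close> blocks of size \<open>1\<close> (\<open>False\<close>).\<close>

definition blocks :: "nat \<Rightarrow> 'a list \<Rightarrow> bool list" where
  "blocks r xs = snd (tfold (\<lambda>acc _ _. split_step r acc) (xs, []) xs)"

lemma polytime_blocks:
  assumes "polytime e (enc_list ea) f"
  shows "polytime e (enc_list enc_bool) (\<lambda>x. blocks r (f x))"
  unfolding blocks_def
proof (rule polytime_snd, rule polytime_tfold[OF assms])
  let ?e = "enc_list ea \<otimes> enc_list enc_bool"
  show "polytime e ?e (\<lambda>x. (f x, []))"
    by (rule polytime_prod[OF assms polytime_const])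
  show "polytime (e \<otimes> ?e \<otimes> ea \<otimes> enc_list ea) ?e (\<lambda>p. split_step r (fst (snd p)))"
    unfolding split_step_def
    by (rule polytime_drop polytime_intros)+
  show "poly_bounded e (\<lambda>_. 4)" by (rule poly_bounded_const)
  have drop: "enc_length (enc_list ea (drop m xs)) \<le> enc_length (enc_list ea xs)" for m xs
    by (induction m arbitrary: xs) (auto simp: drop_Suc intro: order.trans[OF _ enc_length_tl])
  show "enc_length (?e (split_step r acc)) \<le> enc_length (?e acc) + 4" for acc
    using drop[of "Suc r" "fst acc"] enc_length_tl[of ea "fst acc"]
    by (cases acc) (auto simp: split_step_def)
qed

text \<open>Blocks of size one appear only once at most \<open>r\<close> elements are left, so there
  are at most \<open>r\<close> of them; \<open>P\<close> records this together with the conservation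
  of the total. The second claim expresses the count \<open>t / (r + 1) + O(r)\<close> without
  division.\<close>

lemma blocks_weights:
  fixes xs :: "'a list"
  defines "weights \<equiv> \<lambda>r. map (\<lambda>b. if b then Suc r else 1)"
  shows "sum_list (weights r (blocks r xs)) = length xs"
    and "Suc r * length (blocks r xs) \<le> length xs + Suc r * Suc r"
proof -
  let ?f = "tfold (\<lambda>acc (_ :: 'a) _. split_step r acc)"
  let ?F = "\<lambda>bs. length (filter Not bs)"
  define P where "P acc \<longleftrightarrow> sum_list (weights r (snd acc)) + length (fst acc) = length xs \<and>
    (?F (snd acc) = 0 \<or> ?F (snd acc) + length (fst acc) \<le> r)" for acc :: "'a list \<times> bool list"
  have step: "P (split_step r acc)" if "P acc" for acc
    using that unfolding P_def split_step_def weights_def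
    by (auto simp: length_greater_0_conv[symmetric] simp del: length_greater_0_conv)
  have "P (?f acc ys)" if "P acc" for acc ys
    using that by (induction ys arbitrary: acc) (simp_all add: step)
  then have P: "P (?f (xs, []) xs)" by (simp add: P_def weights_def)
  \<comment> \<open>Each step removes at least one element while any is left, so the fold is long
    enough to exhaust the list.\<close>
  have "length (fst (split_step r acc)) \<le> length (fst acc) - 1" for acc :: "'a list \<times> bool list"
    by (auto simp: split_step_def)
  then have "length (fst (?f acc ys)) \<le> length (fst acc) - length ys"
    for acc :: "'a list \<times> bool list" and ys :: "'a list"
  proof (induction ys arbitrary: acc)
    case (Cons a ys)
    show ?case using Cons.IH[OF Cons.prems, of "split_step r acc"] Cons.prems[of acc] by simp
  qed simp
  from this[of "(xs, [])" xs] have nil: "fst (?f (xs, []) xs) = []" by simp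
  show sum: "sum_list (weights r (blocks r xs)) = length xs"
    using P nil by (simp add: P_def blocks_def)
  have F: "?F (blocks r xs) \<le> r"
    using P by (auto simp: P_def blocks_def nil)
  have "Suc r * length bs \<le> sum_list (weights r bs) + Suc r * ?F bs" for bs
    unfolding weights_def by (induction bs) auto
  from this[of "blocks r xs"] show "Suc r * length (blocks r xs) \<le> length xs + Suc r * Suc r"
    using sum mult_left_mono[OF F, of "Suc r"] by simp
qed

section \<open>Enumerating the options of a selector\<close>

primrec coverable :: "nat list list \<Rightarrow> nat \<Rightarrow> nat list \<Rightarrow> bool" where
  "coverable F 0 S \<longleftrightarrow> S = []"
| "coverable F (Suc r) S \<longleftrightarrow> S = [] \<or> (\<exists>T\<in>set F. coverable F r (filter (\<lambda>u. u \<notin> set T) S))"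

text \<open>The depth \<open>r\<close> is a constant: induction on it produces a separate program
  for each \<open>r\<close>, and the search tree has about \<open>length F ^ r\<close>
  leaves.\<close>

lemma polytime_coverable:
  assumes "polytime e (enc_list (enc_list enc_nat)) F" "polytime e (enc_list enc_nat) S"
  shows "polytime e enc_bool (\<lambda>x. coverable (F x) r (S x))"
proof -
  have "polytime (enc_list (enc_list enc_nat) \<otimes> enc_list enc_nat) enc_bool
      (\<lambda>p. coverable (fst p) r (snd p))" (is "polytime ?e _ _")
  proof (induction r)
    case 0
    show ?case unfolding coverable.simps by (rule polytime_intros)+
  next
    case (Suc r)
    have "polytime (?e \<otimes> enc_list enc_nat) enc_bool
        (\<lambda>p. coverable (fst (fst p)) r (filter (\<lambda>u. u \<notin> set (snd p)) (snd (fst p))))"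
      by (rule polytime_comp[OF Suc, where f = "\<lambda>p. (fst (fst p), filter (\<lambda>u. u \<notin> set (snd p)) (snd (fst p)))",
            unfolded fst_conv snd_conv])
        (rule polytime_filter polytime_member polytime_intros)+
    then show ?case unfolding coverable.simps
      by (intro polytime_disj polytime_Bex) (assumption | rule polytime_intros)+
  qed
  from polytime_comp[OF this polytime_prod[OF assms]] show ?thesis by simp
qed

text \<open>A non-empty subsequence is its first element \<open>a\<close> followed by at most
  \<open>j\<close> elements of the tail after \<open>a\<close>. Recursing on the bound and folding
  over the list gives nested folds of constant depth, hence a polynomial result for fixed
  \<open>j\<close>.\<close>

primrec bounded_subseqs :: "nat \<Rightarrow> 'a list \<Rightarrow> 'a list list" where
  "bounded_subseqs 0 xs = [[]]"
| "bounded_subseqs (Suc j) xs =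
    tfold (\<lambda>acc a k. map ((#) a) (bounded_subseqs j k) @ acc) [[]] xs"

declare bounded_subseqs.simps(2) [simp del]

lemma polytime_bounded_subseqs:
  assumes "polytime e (enc_list ea) f"
  shows "polytime e (enc_list (enc_list ea)) (\<lambda>x. bounded_subseqs j (f x))"
proof -
  have "polytime (enc_list ea) (enc_list (enc_list ea)) (bounded_subseqs j)"
  proof (induction j)
    case 0
    show ?case unfolding bounded_subseqs.simps[abs_def] by (rule polytime_const)
  next
    case (Suc j)
    show ?case unfolding bounded_subseqs.simps[abs_def]
      by (rule polytime_tfold_append[OF polytime_id polytime_const])
        (rule polytime_map polytime_comp[OF Suc] polytime_intros)+
  qed
  from polytime_comp[OF this assms] show ?thesis .
qed

text \<open>The usual alternative of taking or skipping the first element, which holds here only up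
  to order. Multisets rather than sets are used so that the absence of repetitions carries
  over.\<close>

lemma mset_bounded_subseqs_Suc:
  "mset (bounded_subseqs (Suc j) (a # xs)) =
    mset (map ((#) a) (bounded_subseqs j xs)) + mset (bounded_subseqs (Suc j) xs)"
  using tfold_append[of "\<lambda>a k. map ((#) a) (bounded_subseqs j k)" "[[]]" xs]
    tfold_append[of "\<lambda>a k. map ((#) a) (bounded_subseqs j k)"
      "map ((#) a) (bounded_subseqs j xs) @ [[]]" xs]
  by (simp add: bounded_subseqs.simps(2))

lemma set_bounded_subseqs_Suc:
  "set (bounded_subseqs (Suc j) (a # xs)) =
    (#) a ` set (bounded_subseqs j xs) \<union> set (bounded_subseqs (Suc j) xs)"
  using arg_cong[OF mset_bounded_subseqs_Suc, of set_mset j a xs] by simp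

text \<open>The last two facts supply the repetition-free lists and the pairwise different parent
  sets that a valid instance requires.\<close>

lemma bounded_subseqs_sets:
  assumes "distinct xs"
  shows "set ` set (bounded_subseqs j xs) = {S. S \<subseteq> set xs \<and> card S \<le> j}"
    and "\<And>S. S \<in> set (bounded_subseqs j xs) \<Longrightarrow> distinct S"
    and "distinct (map set (bounded_subseqs j xs))"
proof -
  have "set ` set (bounded_subseqs j xs) = {S. S \<subseteq> set xs \<and> card S \<le> j} \<and>
    (\<forall>S\<in>set (bounded_subseqs j xs). distinct S) \<and> distinct (map set (bounded_subseqs j xs))"
    using assms
  proof (induction xs arbitrary: j)
    case Nil
    show ?case by (cases j) (auto simp: bounded_subseqs.simps(2))
  next
    case (Cons a xs)
    show ?case
    proof (cases j)
      case 0
      have "S = {}" if "S \<subseteq> set (a # xs)" "card S \<le> 0" for S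
        using that finite_subset[OF that(1)] by simp
      then have "{S. S \<subseteq> set (a # xs) \<and> card S \<le> 0} = {{}}" by (intro equalityI subsetI) auto
      then show ?thesis unfolding 0 by simp
    next
      case (Suc i)
      have xs: "distinct xs" using Cons.prems by simp
      note IH1 = Cons.IH[OF xs, of i, THEN conjunct1] Cons.IH[OF xs, of i, THEN conjunct2, THEN conjunct1]
        Cons.IH[OF xs, of i, THEN conjunct2, THEN conjunct2]
      note IH2 = Cons.IH[OF xs, of j, THEN conjunct1] Cons.IH[OF xs, of j, THEN conjunct2, THEN conjunct1]
        Cons.IH[OF xs, of j, THEN conjunct2, THEN conjunct2]
      have a: "a \<notin> set xs" using Cons.prems by simp
      have sub1: "set S \<subseteq> set xs" if "S \<in> set (bounded_subseqs i xs)" for S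
        using IH1(1) that by blast
      have sub2: "set S \<subseteq> set xs" if "S \<in> set (bounded_subseqs j xs)" for S
        using IH2(1) that by blast
      have "set ` set (bounded_subseqs j (a # xs)) =
          insert a ` {S. S \<subseteq> set xs \<and> card S \<le> i} \<union> {S. S \<subseteq> set xs \<and> card S \<le> j}"
      proof -
        have "set ` set (bounded_subseqs j (a # xs)) =
            insert a ` (set ` set (bounded_subseqs i xs)) \<union> set ` set (bounded_subseqs j xs)"
          unfolding Suc set_bounded_subseqs_Suc by (simp add: image_Un image_image)
        then show ?thesis unfolding IH1(1) IH2(1) .
      qed
      also have "\<dots> = {S. S \<subseteq> set (a # xs) \<and> card S \<le> j}"
      proof (intro equalityI subsetI)
        fix S assume S: "S \<in> {S. S \<subseteq> set (a # xs) \<and> card S \<le> j}"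
        then have fin: "finite S" using finite_subset[of S "set (a # xs)"] by simp
        show "S \<in> insert a ` {S. S \<subseteq> set xs \<and> card S \<le> i} \<union> {S. S \<subseteq> set xs \<and> card S \<le> j}"
        proof (cases "a \<in> S")
          case True
          then have "S = insert a (S - {a})" "card (S - {a}) \<le> i" "S - {a} \<subseteq> set xs"
            using S fin Suc by auto
          then show ?thesis by blast
        next
          case False
          then show ?thesis using S by auto
        qed
      next
        fix S assume "S \<in> insert a ` {S. S \<subseteq> set xs \<and> card S \<le> i} \<union> {S. S \<subseteq> set xs \<and> card S \<le> j}"
        then consider T where "S = insert a T" "T \<subseteq> set xs" "card T \<le> i" | "S \<subseteq> set xs" "card S \<le> j"
          by blast
        then show "S \<in> {S. S \<subseteq> set (a # xs) \<and> card S \<le> j}"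
        proof cases
          case 1
          have "card S \<le> Suc (card T)" unfolding 1(1) by (rule card_insert_le_m1) auto
          then show ?thesis using 1 Suc by auto
        qed auto
      qed
      finally have 1: "set ` set (bounded_subseqs j (a # xs)) = {S. S \<subseteq> set (a # xs) \<and> card S \<le> j}" .
      have 2: "\<forall>S\<in>set (bounded_subseqs j (a # xs)). distinct S"
      proof
        fix S assume "S \<in> set (bounded_subseqs j (a # xs))"
        then consider T where "S = a # T" "T \<in> set (bounded_subseqs i xs)"
          | "S \<in> set (bounded_subseqs j xs)"
          unfolding Suc set_bounded_subseqs_Suc by blast
        then show "distinct S"
        proof cases
          case 1
          then show ?thesis using IH1(2) sub1[of T] a by auto
        next
          case 2
          then show ?thesis using IH2(2) by blast
        qed
      qed
      have "distinct (map set (map ((#) a) (bounded_subseqs i xs) @ bounded_subseqs j xs))"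
      proof -
        have inj: "inj_on set (set (bounded_subseqs i xs))" and dist: "distinct (bounded_subseqs i xs)"
          using IH1(3) by (auto simp: distinct_map)
        have "inj_on (\<lambda>S. insert a (set S)) (set (bounded_subseqs i xs))"
        proof (rule inj_onI)
          fix S T assume *: "S \<in> set (bounded_subseqs i xs)" "T \<in> set (bounded_subseqs i xs)"
            "insert a (set S) = insert a (set T)"
          then have "set S = set T" using sub1 a by (metis insert_ident subsetD)
          then show "S = T" using * inj by (auto dest: inj_onD)
        qed
        then have "distinct (map set (map ((#) a) (bounded_subseqs i xs)))"
          using dist by (simp add: distinct_map inj_on_def)
        moreover have "set ` set (map ((#) a) (bounded_subseqs i xs)) \<inter> set ` set (bounded_subseqs j xs) = {}"
          using sub2 a by fastforce
        ultimately show ?thesis using IH2(3) by (simp only: map_append distinct_append set_map)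
      qed
      moreover have "mset (map set (bounded_subseqs j (a # xs))) =
          mset (map set (map ((#) a) (bounded_subseqs i xs) @ bounded_subseqs j xs))"
        using arg_cong[OF mset_bounded_subseqs_Suc, of "image_mset set" i a xs] Suc
        by (simp add: image_mset.compositionality)
      ultimately have "distinct (map set (bounded_subseqs j (a # xs)))"
        using mset_eq_imp_distinct_iff by metis
      then show ?thesis using 1 2 by blast
    qed
  qed
  then show "set ` set (bounded_subseqs j xs) = {S. S \<subseteq> set xs \<and> card S \<le> j}"
    and "\<And>S. S \<in> set (bounded_subseqs j xs) \<Longrightarrow> distinct S"
    and "distinct (map set (bounded_subseqs j xs))"
    by blast+
qed

lemma polytime_rat_of_nat:
  assumes "polytime e enc_nat f"
  shows "polytime e enc_rat (\<lambda>x. of_nat (f x))"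
proof -
  have "enc_rat (of_nat m) = Pair (Pair Leaf (enc_nat m)) (Pair Leaf (enc_nat 1))" for m
    using quotient_of_int[of "int m"] by (simp add: enc_rat_def enc_int_def)
  then show ?thesis using assms unfolding polytime_def
    by (simp add: ptime_Pair ptime_const)
qed

text \<open>Every non-empty option contains the hub \<open>n\<close>, on which the 4-cycle argument
  relies, but the hub earns no score. The first entry is the mandatory empty parent set.\<close>

definition selector :: "nat \<Rightarrow> nat \<Rightarrow> nat list list \<Rightarrow> nat \<Rightarrow> (nat list \<times> rat) list" where
  "selector K n F c = ([], 0) # map (\<lambda>S. (n # S, of_nat (length S)))
    (filter (coverable F c) (bounded_subseqs K [0..<n]))"

text \<open>Nodes below \<open>n\<close> are the elements of the universe, node \<open>n\<close> is the hub, and the remaining nodes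
  are the selectors; \<open>cs\<close> lists how many sets each selector may use.\<close>

definition reduction :: "nat \<Rightarrow> nat \<Rightarrow> nat list list \<Rightarrow> nat list \<Rightarrow> pt_instance" where
  "reduction K n F cs = map (\<lambda>_. [([], 0)]) [0..<n] @ [[([], 0)]] @ map (selector K n F) cs"

text \<open>\<open>suffix_of_length\<close> reaches only lengths strictly below that of its list, so
  a dummy element in front admits \<open>n\<close> equal to the total size of \<open>F\<close> and
  \<open>t\<close> equal to \<open>length F\<close>. Beyond that the result is empty while the
  number is positive, so the length test detects it. The flag and the list of elements bypass the
  solver and are kept for the final test.\<close>

definition preprocess :: "nat \<Rightarrow> nat \<Rightarrow> sc_instance \<Rightarrow> (bool \<times> nat list) \<times> pt_instance" where
  "preprocess r K z = (let n = fst z; F = fst (snd z); t = snd (snd z);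
      W = suffix_of_length n (0 # concat F); X = suffix_of_length t ([] # F);
      ok = (length W = n \<and> length X = t)
    in ((ok, [0..<length W]),
        if ok then reduction K (length W) F (map (\<lambda>b. if b then Suc r else 1) (blocks r X)) else []))"

lemma enc_sc_eq: "enc_sc = enc_nat \<otimes> enc_list (enc_list enc_nat) \<otimes> enc_nat"
  by (auto simp: enc_sc_def fun_eq_iff)

lemma enc_pt_eq: "enc_pt = enc_list (enc_list (enc_list enc_nat \<otimes> enc_rat))"
  by (simp add: enc_pt_def enc_prod_def)

text \<open>The universe size enters as the length of a list because enumerating
  \<open>[0..<n]\<close> is polynomial only for unary \<open>n\<close>.\<close>

lemma polytime_selector:
  assumes "polytime e (enc_list ea) f" "polytime e (enc_list (enc_list enc_nat)) F"
  shows "polytime e (enc_list (enc_list enc_nat \<otimes> enc_rat)) (\<lambda>x. selector K (length (f x)) (F x) c)"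
  unfolding selector_def
  by (rule polytime_map polytime_filter polytime_coverable polytime_bounded_subseqs
      polytime_rat_of_nat polytime_length polytime_upt_length polytime_comp[OF assms(1)]
      polytime_comp[OF assms(2)] polytime_intros)+

lemma polytime_preprocess:
  "polytime enc_sc ((enc_bool \<otimes> enc_list enc_nat) \<otimes> enc_pt) (preprocess r K)"
proof -
  let ?W = "\<lambda>z :: sc_instance. suffix_of_length (fst z) (0 # concat (fst (snd z)))"
  let ?X = "\<lambda>z :: sc_instance. suffix_of_length (snd (snd z)) ([] # fst (snd z))"
  have W: "polytime enc_sc (enc_list enc_nat) ?W"
    unfolding enc_sc_eq by (rule polytime_suffix_of_length polytime_concat polytime_intros)+
  have X: "polytime enc_sc (enc_list (enc_list enc_nat)) ?X"
    unfolding enc_sc_eq by (rule polytime_suffix_of_length polytime_concat polytime_intros)+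
  have n: "polytime enc_sc enc_nat fst" and t: "polytime enc_sc enc_nat (\<lambda>z. snd (snd z))"
    and F: "polytime enc_sc (enc_list (enc_list enc_nat)) (\<lambda>z. fst (snd z))"
    unfolding enc_sc_eq by (rule polytime_intros)+
  have ok: "polytime enc_sc enc_bool (\<lambda>z. length (?W z) = fst z \<and> length (?X z) = snd (snd z))"
    by (rule polytime_conj polytime_nat_eq polytime_length W X n t)+
  \<comment> \<open>Capacities are constants in \<open>polytime_selector\<close>, and only
    \<open>Suc r\<close> and 1 occur, so the map becomes a choice between two fixed
    programs.\<close>
  have sel: "map (selector K n F) (map (\<lambda>b. if b then Suc r else 1) bs) =
      map (\<lambda>b. if b then selector K n F (Suc r) else selector K n F 1) bs" for n F bs
    by simp
  have red: "polytime enc_sc enc_pt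
    (\<lambda>z. reduction K (length (?W z)) (fst (snd z)) (map (\<lambda>b. if b then Suc r else 1) (blocks r (?X z))))"
    unfolding reduction_def sel enc_pt_eq
    by (rule polytime_append polytime_map polytime_upt_length polytime_blocks W X
        polytime_comp[OF polytime_selector[OF W F]] polytime_intros)+
  show ?thesis unfolding preprocess_def[abs_def] Let_def
    by (rule polytime_prod polytime_if polytime_upt_length polytime_const W red ok)+
qed

text \<open>The solver returns an optimal polytree, not its score, so the answer is read off the
  parent lists: every element must occur as a parent.\<close>

definition postprocess :: "(bool \<times> nat list) \<times> nat list list \<Rightarrow> bool" where
  "postprocess y \<longleftrightarrow> fst (fst y) \<and> (\<forall>u\<in>set (snd (fst y)). \<exists>P\<in>set (snd y). u \<in> set P)"

lemma polytime_postprocess: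
  "polytime ((enc_bool \<otimes> enc_list enc_nat) \<otimes> enc_list (enc_list enc_nat)) enc_bool postprocess"
  unfolding postprocess_def[abs_def]
  by (rule polytime_Bex polytime_Ball polytime_member polytime_intros)+

section \<open>Correctness of the reduction\<close>

lemma coverable_iff:
  "coverable F c S \<longleftrightarrow> (\<exists>C\<subseteq>set ` set F. card C \<le> c \<and> set S \<subseteq> \<Union>C)"
proof (induction c arbitrary: S)
  case 0
  have "finite C" if "C \<subseteq> set ` set F" for C
    using that finite_subset by blast
  then show ?case by auto
next
  case (Suc c)
  show ?case
  proof
    assume cov: "coverable F (Suc c) S"
    show "\<exists>C\<subseteq>set ` set F. card C \<le> Suc c \<and> set S \<subseteq> \<Union>C"
    proof (cases "S = []")
      case True
      then show ?thesis by (intro exI[of _ "{}"]) simp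
    next
      case False
      then obtain T where T: "T \<in> set F" "coverable F c (filter (\<lambda>u. u \<notin> set T) S)"
        using cov by auto
      then obtain C where C: "C \<subseteq> set ` set F" "card C \<le> c" "set (filter (\<lambda>u. u \<notin> set T) S) \<subseteq> \<Union>C"
        using Suc.IH by blast
      have "card (insert (set T) C) \<le> Suc c"
        using C(2) card_insert_le_m1[of "Suc c" C "set T"] by simp
      then show ?thesis using T C by (intro exI[of _ "insert (set T) C"]) auto
    qed
  next
    assume "\<exists>C\<subseteq>set ` set F. card C \<le> Suc c \<and> set S \<subseteq> \<Union>C"
    then obtain C where C: "C \<subseteq> set ` set F" "card C \<le> Suc c" "set S \<subseteq> \<Union>C" by blast
    show "coverable F (Suc c) S"
    proof (cases "S = []")
      case False
      \<comment> \<open>\<open>T\<close> is a member of the cover that contains the first element of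
        \<open>S\<close>.\<close>
      then obtain T where T: "T \<in> set F" "set T \<in> C" using C by (cases S) auto
      have "finite C" using C(1) finite_subset by blast
      then have "card (C - {set T}) \<le> c" using C(2) T(2) by simp
      then have "coverable F c (filter (\<lambda>u. u \<notin> set T) S)"
        unfolding Suc.IH using C by (intro exI[of _ "C - {set T}"]) auto
      then show ?thesis using T(1) by auto
    qed simp
  qed
qed

text \<open>Greedy distribution: the first group receives as many sets of the cover as its capacity
  allows and claims every element of \<open>U\<close> in them; only unclaimed elements are passed
  on, which makes the parts disjoint.\<close>

lemma partition_cover:
  assumes "finite C" "card C \<le> sum_list cs" "U \<subseteq> \<Union>C"
  shows "\<exists>S. (\<forall>i<length cs. \<exists>D\<subseteq>C. card D \<le> cs ! i \<and> S i \<subseteq> \<Union>D) \<and>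
    (\<Union>i<length cs. S i) = U \<and> (\<forall>i<length cs. \<forall>j<length cs. i \<noteq> j \<longrightarrow> S i \<inter> S j = {})"
  using assms
proof (induction cs arbitrary: C U)
  case Nil
  then show ?case by auto
next
  case (Cons c cs)
  obtain D where D: "D \<subseteq> C" "card D = min c (card C)"
    using obtain_subset_with_card_n[of "min c (card C)" C] by auto
  have "card (C - D) \<le> sum_list cs"
    using Cons.prems D by (simp add: card_Diff_subset finite_subset)
  moreover have "U - \<Union>D \<subseteq> \<Union>(C - D)" using Cons.prems(3) by auto
  ultimately have "\<exists>S. (\<forall>i<length cs. \<exists>D'\<subseteq>C - D. card D' \<le> cs ! i \<and> S i \<subseteq> \<Union>D') \<and>
    (\<Union>i<length cs. S i) = U - \<Union>D \<and> (\<forall>i<length cs. \<forall>j<length cs. i \<noteq> j \<longrightarrow> S i \<inter> S j = {})"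
    using Cons.prems(1) by (intro Cons.IH) auto
  then obtain S where S: "\<forall>i<length cs. \<exists>D'\<subseteq>C - D. card D' \<le> cs ! i \<and> S i \<subseteq> \<Union>D'"
    "(\<Union>i<length cs. S i) = U - \<Union>D"
    "\<forall>i<length cs. \<forall>j<length cs. i \<noteq> j \<longrightarrow> S i \<inter> S j = {}"
    by (elim exE conjE)
  let ?S = "case_nat (U \<inter> \<Union>D) S"
  have 1: "\<exists>D'\<subseteq>C. card D' \<le> (c # cs) ! i \<and> ?S i \<subseteq> \<Union>D'" if i: "i < length (c # cs)" for i
  proof (cases i)
    case 0
    then show ?thesis using D by (intro exI[of _ D]) auto
  next
    case (Suc j)
    then obtain D' where "D' \<subseteq> C - D" "card D' \<le> cs ! j" "S j \<subseteq> \<Union>D'"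
      using S(1) i by auto
    then show ?thesis using Suc by (intro exI[of _ D']) auto
  qed
  have "(\<Union>i<length (c # cs). ?S i) = ?S 0 \<union> (\<Union>i<length cs. ?S (Suc i))"
    by (simp only: list.size(4) add_Suc_right add_0_right lessThan_Suc_eq_insert_0) auto
  also have "\<dots> = U" using S(2) by auto
  finally have 2: "(\<Union>i<length (c # cs). ?S i) = U" .
  have sub: "S j \<inter> \<Union>D = {}" if "j < length cs" for j
    using S(2) that by blast
  have "?S i \<inter> ?S j = {}" if "i < length (c # cs)" "j < length (c # cs)" "i \<noteq> j" for i j
  proof (cases i; cases j)
    fix i' j' assume "i = Suc i'" "j = Suc j'"
    then show ?thesis using that S(3) by simp
  next
    fix j' assume "i = 0" "j = Suc j'"
    then show ?thesis using that sub[of j'] by auto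
  next
    fix i' assume "j = 0" "i = Suc i'"
    then show ?thesis using that sub[of i'] by auto
  qed (use that in auto)
  then show ?case using 1 2 by blast
qed

section \<open>Scores of parent sets\<close>

lemma local_score_eq:
  assumes "distinct (map (\<lambda>(S, q). set S) (I ! v))" "(S, q) \<in> set (I ! v)"
  shows "local_score I v (set S) = ereal (real_of_rat q)"
proof -
  have "distinct (map fst (map (\<lambda>(S, q). (set S, q)) (I ! v)))"
    using assms(1) by (simp add: comp_def case_prod_unfold)
  moreover have "(set S, q) \<in> set (map (\<lambda>(S, q). (set S, q)) (I ! v))"
    using assms(2) by force
  ultimately have "map_of (map (\<lambda>(S, q). (set S, q)) (I ! v)) (set S) = Some q"
    by (rule map_of_is_SomeI)
  then show ?thesis by (simp add: local_score_def)
qed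

lemma local_score_not_potential:
  assumes "P \<notin> potential_parents I v"
  shows "local_score I v P = -\<infinity>"
proof -
  have "map_of (map (\<lambda>(S, q). (set S, q)) (I ! v)) P = None"
    using assms by (force simp: map_of_eq_None_iff potential_parents_def)
  then show ?thesis by (simp add: local_score_def)
qed

lemma local_score_not_PInf: "local_score I v P \<noteq> \<infinity>"
  by (auto simp: local_score_def split: option.splits)

text \<open>A summand \<open>-\<infinity>\<close> decides the sum because no local score is
  \<open>\<infinity>\<close>. Hence a single forbidden parent set ruins the polytree.\<close>

lemma score_MInf:
  assumes "v \<in> nodes I" "local_score I v (parents A v) = -\<infinity>"
  shows "score I A = -\<infinity>"
proof -
  have "finite (nodes I)" by (simp add: nodes_def)
  then have "score I A = local_score I v (parents A v) +
      (\<Sum>u\<in>nodes I - {v}. local_score I u (parents A u))"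
    unfolding score_def using assms(1) by (rule sum.remove)
  moreover have "(\<Sum>u\<in>nodes I - {v}. local_score I u (parents A u)) \<noteq> \<infinity>"
    by (simp add: sum_Pinfty local_score_not_PInf)
  ultimately show ?thesis using assms(2) by simp
qed

lemma is_cycle_4:
  assumes "distinct [a, b, c, d]" "{a, b} \<in> E" "{b, c} \<in> E" "{c, d} \<in> E" "{d, a} \<in> E"
  shows "is_cycle E [a, b, c, d]"
proof -
  have "{[a, b, c, d] ! i, [a, b, c, d] ! (Suc i mod 4)} \<in> E" if "i < 4" for i
  proof -
    have "i = 0 \<or> i = 1 \<or> i = 2 \<or> i = 3" using that by linarith
    then show ?thesis using assms by (elim disjE) simp_all
  qed
  then show ?thesis using assms(1) by (simp add: is_cycle_def)
qed

text \<open>Here \<open>r\<close> bounds the capacities themselves, so it is instantiated with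
  \<open>Suc r\<close> later, and \<open>K\<close> bounds the number of elements that
  \<open>r\<close> sets can cover.\<close>

locale set_cover_reduction =
  fixes k n t r K :: nat and F :: "nat list list" and cs :: "nat list"
  assumes instance_k: "(n, F, t) \<in> sc_instances k"
    and capacities: "\<And>c. c \<in> set cs \<Longrightarrow> c \<le> r"
    and sum_capacities: "sum_list cs = t"
    and K_def: "K = r * k"
begin

abbreviation I :: pt_instance where
  "I \<equiv> reduction K n F cs"

abbreviation covers :: "nat \<Rightarrow> nat set \<Rightarrow> bool" where
  "covers c S \<equiv> \<exists>C\<subseteq>set ` set F. card C \<le> c \<and> S \<subseteq> \<Union>C"

lemma nodes_I: "nodes I = {..<n} \<union> {n} \<union> (\<lambda>i. n + 1 + i) ` {..<length cs}"
proof -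
  have "nodes I = {..<n + 1 + length cs}" by (simp add: nodes_def reduction_def)
  also have "\<dots> = {..<n} \<union> {n} \<union> (\<lambda>i. n + 1 + i) ` {..<length cs}"
  proof (intro equalityI subsetI)
    fix v assume v: "v \<in> {..<n + 1 + length cs}"
    show "v \<in> {..<n} \<union> {n} \<union> (\<lambda>i. n + 1 + i) ` {..<length cs}"
    proof (cases "v \<le> n")
      case False
      then have "v = n + 1 + (v - n - 1)" "v - n - 1 < length cs" using v by auto
      then show ?thesis by blast
    qed auto
  qed auto
  finally show ?thesis .
qed

lemma I_nth_low: "v \<le> n \<Longrightarrow> I ! v = [([], 0)]"
  by (auto simp: reduction_def nth_append)

lemma I_nth_selector: "i < length cs \<Longrightarrow> I ! (n + 1 + i) = selector K n F (cs ! i)"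
  by (simp add: reduction_def nth_append)

lemma distinct_low: "v \<le> n \<Longrightarrow> distinct (map (\<lambda>(S, q). set S) (I ! v))"
  by (simp add: I_nth_low)

lemma subseqs_sets: "set ` set (bounded_subseqs K [0..<n]) = {S. S \<subseteq> {..<n} \<and> card S \<le> K}"
  using bounded_subseqs_sets(1)[OF distinct_upt, of K 0 n] unfolding set_upt atLeast0LessThan .

lemma subseq_lt: "S \<in> set (bounded_subseqs K [0..<n]) \<Longrightarrow> set S \<subseteq> {..<n}"
  using subseqs_sets by blast

lemma distinct_selector: "distinct (map (\<lambda>(S, q). set S) (selector K n F c))"
proof -
  let ?B = "filter (coverable F c) (bounded_subseqs K [0..<n])"
  have "distinct (map set ?B)"
    using bounded_subseqs_sets(3)[of "[0..<n]" K] by (intro distinct_map_filter) simp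
  moreover have "inj_on (insert n) (set (map set ?B))"
  proof (rule inj_onI)
    fix S T assume *: "S \<in> set (map set ?B)" "T \<in> set (map set ?B)" "insert n S = insert n T"
    then have "n \<notin> S" "n \<notin> T" using subseq_lt by auto
    then show "S = T" using *(3) by (metis insert_ident)
  qed
  ultimately have "distinct (map (insert n) (map set ?B))" by (simp only: distinct_map)
  then show ?thesis by (auto simp: selector_def comp_def)
qed

lemma potential_low: "v \<le> n \<Longrightarrow> potential_parents I v = {{}}"
  by (simp add: potential_parents_def I_nth_low)

lemma potential_selector:
  assumes "i < length cs"
  shows "potential_parents I (n + 1 + i) =
    insert {} (insert n ` {S. S \<subseteq> {..<n} \<and> card S \<le> K \<and> covers (cs ! i) S})"
proof -
  let ?B = "set (bounded_subseqs K [0..<n])"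
  have "potential_parents I (n + 1 + i) =
      insert {} (insert n ` set ` {S \<in> ?B. coverable F (cs ! i) S})"
    unfolding potential_parents_def I_nth_selector[OF assms] selector_def
    by (auto simp: image_image)
  also have "set ` {S \<in> ?B. coverable F (cs ! i) S} = {S \<in> set ` ?B. covers (cs ! i) S}"
    unfolding coverable_iff by auto
  also have "\<dots> = {S. S \<subseteq> {..<n} \<and> card S \<le> K \<and> covers (cs ! i) S}"
    unfolding subseqs_sets by blast
  finally show ?thesis .
qed

lemma local_score_empty: "v \<in> nodes I \<Longrightarrow> local_score I v {} = 0"
proof -
  assume "v \<in> nodes I"
  then consider "v \<le> n" | i where "i < length cs" "v = n + 1 + i" unfolding nodes_I by auto
  then show ?thesis
  proof cases
    case 1
    then show ?thesis using local_score_eq[OF distinct_low[OF 1], of "[]" 0] by (simp add: I_nth_low)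
  next
    case 2
    then show ?thesis
      using local_score_eq[of I "n + 1 + i" "[]" 0] distinct_selector I_nth_selector[OF 2(1)]
      by (simp add: selector_def)
  qed
qed

lemma local_score_selector:
  assumes "i < length cs" "S \<subseteq> {..<n}" "card S \<le> K" "covers (cs ! i) S"
  shows "local_score I (n + 1 + i) (insert n S) = ereal (card S)"
proof -
  have "S \<in> set ` set (bounded_subseqs K [0..<n])"
    unfolding subseqs_sets using assms(2,3) by blast
  then obtain xs where xs: "xs \<in> set (bounded_subseqs K [0..<n])" "set xs = S" by blast
  have "length xs = card S"
    using xs bounded_subseqs_sets(2)[of "[0..<n]" xs K] by (metis distinct_card distinct_upt)
  moreover have "(n # xs, of_nat (length xs)) \<in> set (I ! (n + 1 + i))"
    unfolding I_nth_selector[OF assms(1)] selector_def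
    using xs assms(4) by (auto simp: coverable_iff)
  moreover have "distinct (map (\<lambda>(S, q). set S) (I ! (n + 1 + i)))"
    unfolding I_nth_selector[OF assms(1)] by (rule distinct_selector)
  ultimately show ?thesis
    using local_score_eq[of I "n + 1 + i" "n # xs" "of_nat (length xs)"] xs(2) by simp
qed

lemma I_valid: "I \<in> pt_le_instances (Suc K)"
proof -
  have "(\<forall>(S, q)\<in>set (I ! v). distinct S \<and> set S \<subseteq> nodes I - {v}) \<and>
      distinct (map (\<lambda>(S, q). set S) (I ! v)) \<and> {} \<in> potential_parents I v \<and>
      (\<forall>S\<in>potential_parents I v. card S \<le> Suc K)" if v: "v \<in> nodes I" for v
  proof -
    from v consider "v \<le> n" | i where "i < length cs" "v = n + 1 + i" unfolding nodes_I by auto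
    then show ?thesis
    proof cases
      case 1
      then show ?thesis using distinct_low[OF 1] by (auto simp: potential_low I_nth_low)
    next
      case 2
      have "distinct S \<and> set S \<subseteq> nodes I - {v}" if "(S, q) \<in> set (selector K n F (cs ! i))" for S q
      proof -
        from that consider "S = []" | T where "S = n # T" "T \<in> set (bounded_subseqs K [0..<n])"
          by (auto simp: selector_def)
        then show ?thesis
        proof cases
          case 2: 2
          then show ?thesis
            using subseq_lt[OF 2(2)] bounded_subseqs_sets(2)[of "[0..<n]" T K] \<open>v = n + 1 + i\<close>
            unfolding nodes_I by auto
        qed simp
      qed
      moreover have "card (insert n S) \<le> Suc K" if "card S \<le> K" for S
        using that card_insert_le_m1[of "Suc K" S n] by simp
      ultimately show ?thesis
        using 2 potential_selector[OF 2(1)] distinct_selector I_nth_selector[OF 2(1)] by auto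
    qed
  qed
  then show ?thesis
    unfolding pt_le_instances_def pt_instances_def by (auto simp: local_score_empty)
qed

lemma score_split:
  assumes "\<And>v. v \<le> n \<Longrightarrow> parents A v = {}"
  shows "score I A = (\<Sum>i<length cs. local_score I (n + 1 + i) (parents A (n + 1 + i)))"
proof -
  let ?f = "\<lambda>v. local_score I v (parents A v)"
  have "score I A = (\<Sum>v\<in>(\<lambda>i. n + 1 + i) ` {..<length cs}. ?f v)"
    unfolding score_def
  proof (rule sum.mono_neutral_right)
    show "\<forall>v\<in>nodes I - (\<lambda>i. n + 1 + i) ` {..<length cs}. ?f v = 0"
    proof
      fix v assume v: "v \<in> nodes I - (\<lambda>i. n + 1 + i) ` {..<length cs}"
      then have "v \<le> n" unfolding nodes_I by auto
      then show "?f v = 0" using v assms local_score_empty by simp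
    qed
  qed (auto simp: nodes_I)
  also have "\<dots> = (\<Sum>i<length cs. ?f (n + 1 + i))"
    by (subst sum.reindex) (auto simp: inj_on_def)
  finally show ?thesis .
qed

text \<open>A score other than \<open>-\<infinity>\<close> forces every node to use one of its
  listed parent sets, so the shape of the lists determines the shape of the polytree.\<close>

lemma polytree_parents:
  assumes "polytree (nodes I) A" "score I A \<noteq> -\<infinity>"
  shows "\<And>v. v \<le> n \<Longrightarrow> parents A v = {}"
    and "\<And>i. i < length cs \<Longrightarrow> parents A (n + 1 + i) \<noteq> {} \<Longrightarrow> n \<in> parents A (n + 1 + i)"
    and "\<And>i. i < length cs \<Longrightarrow> parents A (n + 1 + i) - {n} \<subseteq> {..<n}"
    and "\<And>i. i < length cs \<Longrightarrow> covers (cs ! i) (parents A (n + 1 + i) - {n})"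
    and "\<And>i. i < length cs \<Longrightarrow>
      local_score I (n + 1 + i) (parents A (n + 1 + i)) = ereal (card (parents A (n + 1 + i) - {n}))"
proof -
  have pot: "parents A v \<in> potential_parents I v" if "v \<in> nodes I" for v
    using score_MInf[OF that] local_score_not_potential assms(2) by blast
  show "parents A v = {}" if "v \<le> n" for v
  proof -
    have "v \<in> nodes I" using that by (auto simp: nodes_I)
    then show ?thesis using pot[of v] potential_low[OF that] by simp
  qed
  have sel: "parents A (n + 1 + i) = {} \<or> (\<exists>S. parents A (n + 1 + i) = insert n S \<and> S \<subseteq> {..<n} \<and>
      card S \<le> K \<and> covers (cs ! i) S)" if "i < length cs" for i
  proof -
    have "n + 1 + i \<in> nodes I" using that by (auto simp: nodes_I)
    then show ?thesis using pot[of "n + 1 + i"] unfolding potential_selector[OF that] by blast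
  qed
  have minus: "insert n S - {n} = S" if "S \<subseteq> {..<n}" for S using that by auto
  fix i assume i: "i < length cs"
  show "n \<in> parents A (n + 1 + i)" if "parents A (n + 1 + i) \<noteq> {}" using sel[OF i] that by blast
  show "parents A (n + 1 + i) - {n} \<subseteq> {..<n}" using sel[OF i] minus by blast
  have emp: "covers (cs ! i) {}" by (intro exI[of _ "{}"]) simp
  show "covers (cs ! i) (parents A (n + 1 + i) - {n})"
  proof (cases "parents A (n + 1 + i) = {}")
    case True
    then show ?thesis using emp by simp
  next
    case False
    then show ?thesis using sel[OF i] minus by metis
  qed
  show "local_score I (n + 1 + i) (parents A (n + 1 + i)) = ereal (card (parents A (n + 1 + i) - {n}))"
  proof (cases "parents A (n + 1 + i) = {}")
    case True
    have "n + 1 + i \<in> nodes I" using i by (simp add: nodes_I)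
    then show ?thesis using True local_score_empty by simp
  next
    case False
    then show ?thesis using sel[OF i] minus local_score_selector[OF i] by metis
  qed
qed

text \<open>Two selectors sharing an element \<open>u\<close> would close the cycle \<open>u\<close>, selector, hub, selector.\<close>

lemma selectors_disjoint:
  assumes A: "polytree (nodes I) A" "score I A \<noteq> -\<infinity>"
    and ij: "i < length cs" "j < length cs" "i \<noteq> j"
  shows "(parents A (n + 1 + i) - {n}) \<inter> (parents A (n + 1 + j) - {n}) = {}"
proof (rule ccontr)
  assume "\<not> ?thesis"
  then obtain u where u: "u \<in> parents A (n + 1 + i)" "u \<in> parents A (n + 1 + j)" "u \<noteq> n" by blast
  then have hub: "n \<in> parents A (n + 1 + i)" "n \<in> parents A (n + 1 + j)"
    using polytree_parents(2)[OF A] ij by blast+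
  have "u < n" using polytree_parents(3)[OF A ij(1)] u by blast
  have edge: "{x, v} \<in> skeleton A" "{v, x} \<in> skeleton A" if "x \<in> parents A v" for x v
    using that by (auto simp: skeleton_def parents_def insert_commute)
  have "is_cycle (skeleton A) [u, n + 1 + i, n, n + 1 + j]"
  proof (rule is_cycle_4)
    show "distinct [u, n + 1 + i, n, n + 1 + j]" using \<open>u < n\<close> ij(3) by auto
  qed (use edge u hub in blast)+
  then show False using A(1) unfolding polytree_def forest_def by blast
qed

abbreviation selected :: "(nat \<times> nat) set \<Rightarrow> nat set" where
  "selected A \<equiv> \<Union>i<length cs. parents A (n + 1 + i) - {n}"

text \<open>Disjointness of the choices turns the sum of their sizes into the size of their
  union.\<close>

lemma score_polytree:
  assumes A: "polytree (nodes I) A" "score I A \<noteq> -\<infinity>"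
  shows "score I A = ereal (card (selected A))"
proof -
  have "score I A = (\<Sum>i<length cs. local_score I (n + 1 + i) (parents A (n + 1 + i)))"
    by (rule score_split) (rule polytree_parents(1)[OF A])
  also have "\<dots> = (\<Sum>i<length cs. ereal (card (parents A (n + 1 + i) - {n})))"
    using polytree_parents(5)[OF A] by (intro sum.cong) auto
  also have "\<dots> = ereal (\<Sum>i<length cs. real (card (parents A (n + 1 + i) - {n})))"
    by (rule sum_ereal)
  also have "(\<Sum>i<length cs. real (card (parents A (n + 1 + i) - {n}))) = real (card (selected A))"
  proof -
    have "card (selected A) = (\<Sum>i<length cs. card (parents A (n + 1 + i) - {n}))"
    proof (rule card_UN_disjoint)
      show "\<forall>i\<in>{..<length cs}. finite (parents A (n + 1 + i) - {n})"
        using polytree_parents(3)[OF A] finite_subset[OF _ finite_lessThan] by blast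
      show "\<forall>i\<in>{..<length cs}. \<forall>j\<in>{..<length cs}. i \<noteq> j \<longrightarrow>
          (parents A (n + 1 + i) - {n}) \<inter> (parents A (n + 1 + j) - {n}) = {}"
        using selectors_disjoint[OF A] by blast
    qed simp
    then show ?thesis by simp
  qed
  finally show ?thesis .
qed

lemma selected_covered:
  assumes A: "polytree (nodes I) A" "score I A \<noteq> -\<infinity>"
  shows "covers t (selected A)"
proof -
  have "\<forall>i\<in>{..<length cs}. \<exists>C. C \<subseteq> set ` set F \<and> card C \<le> cs ! i \<and>
      parents A (n + 1 + i) - {n} \<subseteq> \<Union>C"
    using polytree_parents(4)[OF A] by (simp only: lessThan_iff Ball_def) simp
  from bchoice[OF this] obtain C where C: "\<forall>i\<in>{..<length cs}. C i \<subseteq> set ` set F \<and>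
      card (C i) \<le> cs ! i \<and> parents A (n + 1 + i) - {n} \<subseteq> \<Union>(C i)"
    by (elim exE)
  have "card (\<Union>i<length cs. C i) \<le> (\<Sum>i<length cs. card (C i))"
    by (rule card_UN_le) simp
  also have "\<dots> \<le> (\<Sum>i<length cs. cs ! i)" using C by (intro sum_mono) simp
  also have "\<dots> = t"
    using sum_capacities by (simp add: sum_list_sum_nth atLeast0LessThan)
  finally have "card (\<Union>i<length cs. C i) \<le> t" .
  moreover have "(\<Union>i<length cs. C i) \<subseteq> set ` set F" using C by (intro UN_least) simp
  moreover have "selected A \<subseteq> \<Union>(\<Union>i<length cs. C i)"
  proof (rule UN_least)
    fix i assume i: "i \<in> {..<length cs}"
    then have "parents A (n + 1 + i) - {n} \<subseteq> \<Union>(C i)" using C by simp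
    also have "\<dots> \<subseteq> \<Union>(\<Union>i<length cs. C i)" using i by blast
    finally show "parents A (n + 1 + i) - {n} \<subseteq> \<Union>(\<Union>i<length cs. C i)" .
  qed
  ultimately show ?thesis by (intro exI[of _ "\<Union>i<length cs. C i"] conjI)
qed

text \<open>A disjoint distribution of the universe gives a tree: the hub and the selectors form a
  star, and every element is pendant at exactly one selector, so it cannot lie on a cycle.\<close>

lemma polytree_of_cover:
  assumes "covers t {..<n}"
  shows "\<exists>A. polytree (nodes I) A \<and> score I A \<ge> ereal n"
proof -
  obtain C where C: "C \<subseteq> set ` set F" "card C \<le> t" "{..<n} \<subseteq> \<Union>C" using assms by blast
  have "finite C" using C(1) finite_subset by blast
  then have "\<exists>S. (\<forall>i<length cs. \<exists>D\<subseteq>C. card D \<le> cs ! i \<and> S i \<subseteq> \<Union>D) \<and>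
    (\<Union>i<length cs. S i) = {..<n} \<and> (\<forall>i<length cs. \<forall>j<length cs. i \<noteq> j \<longrightarrow> S i \<inter> S j = {})"
    using C(2,3) sum_capacities by (intro partition_cover) auto
  then obtain S where S: "\<forall>i<length cs. \<exists>D\<subseteq>C. card D \<le> cs ! i \<and> S i \<subseteq> \<Union>D"
    "(\<Union>i<length cs. S i) = {..<n}"
    "\<forall>i<length cs. \<forall>j<length cs. i \<noteq> j \<longrightarrow> S i \<inter> S j = {}"
    by (elim exE conjE)
  have sub: "S i \<subseteq> {..<n}" if "i < length cs" for i using S(2) that by blast
  have cov: "covers (cs ! i) (S i)" if "i < length cs" for i
    using S(1) that C(1) by (meson order.trans)
  \<comment> \<open>At most \<open>r\<close> sets of size at most \<open>k\<close> cover the choice,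
    so it is small enough to be among the listed options.\<close>
  have card: "card (S i) \<le> K" if i: "i < length cs" for i
  proof -
    obtain D where D: "D \<subseteq> set ` set F" "card D \<le> cs ! i" "S i \<subseteq> \<Union>D" using cov[OF i] by blast
    have "finite D" using D(1) finite_subset by blast
    have le: "finite T \<and> card T \<le> k" if "T \<in> D" for T
      using that D(1) instance_k by (auto simp: sc_instances_def)
    have "card (S i) \<le> card (\<Union>D)"
      using D(3) \<open>finite D\<close> le by (intro card_mono) auto
    also have "\<dots> \<le> (\<Sum>T\<in>D. card T)" using card_Union_le_sum_card by blast
    also have "\<dots> \<le> card D * k" using sum_bounded_above[of D card k] le by simp
    also have "\<dots> \<le> r * k"
      using D(2) capacities[of "cs ! i"] i by (intro mult_right_mono) auto
    finally show ?thesis by (simp add: K_def)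
  qed
  define A where "A = {(u, n + 1 + i) | u i. i < length cs \<and> u \<in> insert n (S i)}"
  have parents_low: "parents A v = {}" if "v \<le> n" for v
    using that by (auto simp: parents_def A_def)
  have parents_sel: "parents A (n + 1 + i) = insert n (S i)" if "i < length cs" for i
    using that by (auto simp: parents_def A_def)
  have A: "u \<le> n \<and> (\<exists>i<length cs. v = n + 1 + i \<and> u \<in> insert n (S i))" if "(u, v) \<in> A" for u v
    using that sub unfolding A_def by auto (meson lessThan_iff less_imp_le subsetD)
  have "acyclic A"
    by (rule acyclic_subset[OF wf_acyclic[OF wf_less_than]]) (use A in fastforce)
  moreover have "A \<subseteq> nodes I \<times> nodes I"
  proof
    fix p assume "p \<in> A"
    then show "p \<in> nodes I \<times> nodes I"
      using A[of "fst p" "snd p"] by (cases p) (auto simp: nodes_I)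
  qed
  moreover have "forest (skeleton A)"
    unfolding forest_def
  proof
    assume "\<exists>xs. is_cycle (skeleton A) xs"
    then obtain xs where len: "length xs \<ge> 3" and dist: "distinct xs"
      and edges: "\<And>i. i < length xs \<Longrightarrow> {xs ! i, xs ! (Suc i mod length xs)} \<in> skeleton A"
      unfolding is_cycle_def by blast
    let ?L = "length xs"
    have edge: "x \<le> n \<and> y > n \<and> x \<in> parents A y \<or> y \<le> n \<and> x > n \<and> y \<in> parents A x"
      if "{x, y} \<in> skeleton A" for x y
    proof -
      from that have "(x, y) \<in> A \<or> (y, x) \<in> A" by (auto simp: skeleton_def doubleton_eq_iff)
      then show ?thesis using A[of x y] A[of y x] by (auto simp: parents_def)
    qed
    have inj: "xs ! i = xs ! j \<longleftrightarrow> i = j" if "i < ?L" "j < ?L" for i j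
      using dist that by (simp add: nth_eq_iff_index_eq)
    \<comment> \<open>Every edge joins a node up to \<open>n\<close> with a selector. Without an
      element on the cycle the hub would be its only node up to \<open>n\<close>, yet three
      consecutive edges meet such nodes at two different positions.\<close>
    have "\<exists>i<?L. xs ! i < n"
    proof (rule ccontr)
      assume "\<not> ?thesis"
      then have hub: "xs ! i = n" if "i < ?L" "xs ! i \<le> n" for i
        using that by force
      have L: "0 < ?L" "1 < ?L" "2 < ?L" using len by linarith+
      then have L3: "3 mod ?L < ?L" using mod_less_divisor by blast
      have suc: "Suc 0 mod ?L = 1" "Suc 1 mod ?L = 2" "Suc 2 mod ?L = 3 mod ?L" using len by simp_all
      note e0 = edges[OF L(1), unfolded suc] and e1 = edges[OF L(2), unfolded suc]
        and e2 = edges[OF L(3), unfolded suc]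
      show False
      proof (cases "xs ! 1 \<le> n")
        case True
        then have "xs ! 2 > n" using edge[OF e1] by auto
        then have "xs ! (3 mod ?L) \<le> n" using edge[OF e2] by auto
        then have "3 mod ?L = 1" using hub L L3 True inj by metis
        \<comment> \<open>\<open>3 mod ?L\<close> is 0 for a triangle and 3 otherwise.\<close>
        then show False using len by (cases "?L = 3") auto
      next
        case False
        then have "xs ! 0 \<le> n" "xs ! 2 \<le> n" using edge[OF e0] edge[OF e1] by auto
        then have "(0::nat) = 2" using hub L inj by metis
        then show False by simp
      qed
    qed
    then obtain i where i: "i < ?L" "xs ! i < n" by blast
    \<comment> \<open>The predecessor and successor of the element on the cycle are both selectors,
      and they differ because the cycle has length at least three; so two choices would share the
      element.\<close>
    define p where "p = (if i = 0 then ?L - 1 else i - 1)"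
    let ?q = "Suc i mod ?L"
    have p: "p < ?L" "Suc p mod ?L = i"
      using i(1) len by (auto simp: p_def)
    have "?L > 0" using len by linarith
    then have q: "?q < ?L" by (rule mod_less_divisor)
    have "p \<noteq> ?q"
      using i(1) len by (cases "Suc i = ?L") (auto simp: p_def)
    have ne: "xs ! p \<noteq> xs ! ?q" using inj p(1) q \<open>p \<noteq> ?q\<close> by blast
    have "{xs ! p, xs ! i} \<in> skeleton A" "{xs ! i, xs ! ?q} \<in> skeleton A"
      using edges[of p] edges[of i] p i(1) by auto
    then have "xs ! i \<in> parents A (xs ! p)" "xs ! i \<in> parents A (xs ! ?q)"
      using edge[of "xs ! p" "xs ! i"] edge[of "xs ! i" "xs ! ?q"] i(2) by auto
    moreover have "\<exists>a<length cs. w = n + 1 + a \<and> xs ! i \<in> S a" if "xs ! i \<in> parents A w" for w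
      using A[of "xs ! i" w] that i(2) by (auto simp: parents_def)
    ultimately obtain a b where "a < length cs" "xs ! p = n + 1 + a" "xs ! i \<in> S a"
      "b < length cs" "xs ! ?q = n + 1 + b" "xs ! i \<in> S b"
      by meson
    then show False using S(3) ne by auto
  qed
  ultimately have poly: "polytree (nodes I) A" unfolding polytree_def dag_def by blast
  have "score I A = (\<Sum>i<length cs. local_score I (n + 1 + i) (parents A (n + 1 + i)))"
    by (rule score_split) (rule parents_low)
  also have "\<dots> = (\<Sum>i<length cs. ereal (card (S i)))"
  proof (rule sum.cong)
    fix i assume "i \<in> {..<length cs}"
    then have i: "i < length cs" by simp
    show "local_score I (n + 1 + i) (parents A (n + 1 + i)) = ereal (card (S i))"
      unfolding parents_sel[OF i] by (rule local_score_selector[OF i sub[OF i] card[OF i] cov[OF i]])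
  qed simp
  finally have "score I A \<noteq> -\<infinity>" by simp
  from score_polytree[OF poly this] have "score I A = ereal (card (selected A))" .
  moreover have "selected A = (\<Union>i<length cs. S i)"
  proof (rule SUP_cong)
    fix i assume "i \<in> {..<length cs}"
    then show "parents A (n + 1 + i) - {n} = S i"
      using parents_sel[of i] sub[of i] by auto
  qed simp
  ultimately show ?thesis using poly S(2) by auto
qed

lemma max_score_polytree_covers_iff:
  assumes max: "max_score_polytree I A"
  shows "(\<forall>u<n. \<exists>v\<in>nodes I. u \<in> parents A v) \<longleftrightarrow> covers t {..<n}"
proof -
  have A: "polytree (nodes I) A" and opt: "\<And>B. polytree (nodes I) B \<Longrightarrow> score I B \<le> score I A"
    using max unfolding max_score_polytree_def by auto
  \<comment> \<open>The polytree without arcs scores 0, so an optimum cannot score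
    \<open>-\<infinity>\<close>.\<close>
  have "polytree (nodes I) {}"
    by (auto simp: polytree_def dag_def forest_def is_cycle_def skeleton_def acyclic_def
        intro!: exI[of _ 0])
  moreover have "score I {} = 0"
    unfolding score_def parents_def using local_score_empty by simp
  ultimately have fin: "score I A \<noteq> -\<infinity>" using opt[of "{}"] by auto
  have sub: "selected A \<subseteq> {..<n}" using polytree_parents(3)[OF A fin] by blast
  have eq: "(\<forall>u<n. \<exists>v\<in>nodes I. u \<in> parents A v) \<longleftrightarrow> selected A = {..<n}"
  proof
    assume *: "\<forall>u<n. \<exists>v\<in>nodes I. u \<in> parents A v"
    have "u \<in> selected A" if u: "u < n" for u
    proof -
      obtain v where v: "v \<in> nodes I" "u \<in> parents A v" using * u by blast
      then have "\<not> v \<le> n" using polytree_parents(1)[OF A fin] by auto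
      then obtain i where "i < length cs" "v = n + 1 + i" using v(1) unfolding nodes_I by auto
      then show ?thesis using v(2) u by auto
    qed
    then show "selected A = {..<n}" using sub by blast
  next
    assume "selected A = {..<n}"
    then show "\<forall>u<n. \<exists>v\<in>nodes I. u \<in> parents A v"
      unfolding nodes_I by blast
  qed
  show ?thesis unfolding eq
  proof
    assume "selected A = {..<n}"
    then show "covers t {..<n}" using selected_covered[OF A fin] by simp
  next
    assume "covers t {..<n}"
    then obtain B where "polytree (nodes I) B" "score I B \<ge> ereal n"
      using polytree_of_cover by blast
    then have "ereal n \<le> ereal (card (selected A))"
      using opt[of B] score_polytree[OF A fin] order.trans by metis
    then have "card {..<n} \<le> card (selected A)" by simp
    then show "selected A = {..<n}" using sub card_seteq[of "{..<n}"] by blast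
  qed
qed

text \<open>A cover must consist of exactly \<open>t\<close> different sets. A smaller one can be
  padded with further members of \<open>F\<close> if there are enough, and this adds nothing outside
  the universe.\<close>

lemma has_set_cover_iff: "has_set_cover (n, F, t) \<longleftrightarrow> t \<le> length F \<and> covers t {..<n}"
proof -
  have card: "card (set ` set F) = length F"
    using instance_k distinct_card[of "map set F"] by (simp add: sc_instances_def)
  have sub: "\<Union>(set ` set F) \<subseteq> {..<n}" using instance_k by (auto simp: sc_instances_def)
  show ?thesis
  proof
    assume "has_set_cover (n, F, t)"
    then obtain C where C: "C \<subseteq> set ` set F" "card C = t" "\<Union>C = {..<n}"
      by (auto simp: has_set_cover_def)
    then have "t \<le> length F" using card_mono[of "set ` set F" C] card by simp
    then show "t \<le> length F \<and> covers t {..<n}" using C by blast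
  next
    assume *: "t \<le> length F \<and> covers t {..<n}"
    then obtain C where C: "C \<subseteq> set ` set F" "card C \<le> t" "{..<n} \<subseteq> \<Union>C" by blast
    obtain D where D: "C \<subseteq> D" "D \<subseteq> set ` set F" "card D = t"
      using exists_subset_between[of C t "set ` set F"] C * card by auto
    have "\<Union>D = {..<n}"
    proof
      show "\<Union>D \<subseteq> {..<n}" using D(2) sub by blast
      show "{..<n} \<subseteq> \<Union>D" using C(3) D(1) by blast
    qed
    then show "has_set_cover (n, F, t)" using D by (auto simp: has_set_cover_def)
  qed
qed

end

section \<open>Running time\<close>

primrec vars :: "com \<Rightarrow> var set" where
  "vars Skip = {}"
| "vars (SetLeaf x) = {x}"
| "vars (Copy x y) = {x, y}"
| "vars (SetPair x y z) = {x, y, z}"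
| "vars (SetHd x y) = {x, y}"
| "vars (SetTl x y) = {x, y}"
| "vars (Seq c d) = vars c \<union> vars d"
| "vars (If x c d) = {x} \<union> vars c \<union> vars d"
| "vars (While x c) = {x} \<union> vars c"

lemma finite_vars: "finite (vars c)"
  by (induction c) auto

lemma exec_frame: "exec c s n s' \<Longrightarrow> v \<notin> vars c \<Longrightarrow> s' v = s v"
  by (induction rule: exec.induct) auto

text \<open>Unlike the programs of \<open>ptime\<close>, the solver \<open>p\<close> may depend on
  all other registers being \<open>Leaf\<close>, while preprocessing leaves garbage behind. It is
  therefore run above all registers that preprocessing mentions, which are still \<open>Leaf\<close>
  by the frame property; the information for postprocessing waits in register 0.\<close>

lemma outputs_within_wrap:
  assumes pre: "polytime e (ei \<otimes> em) f" and post: "polytime (ei \<otimes> eo) e' g"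
  shows "\<exists>q c. \<forall>x y T. outputs_within p (em (snd (f x))) T (eo y) \<longrightarrow>
    outputs_within q (e x) (T + real (c * enc_length (e x) ^ c +
      c * enc_length ((ei \<otimes> eo) (fst (f x), y)) ^ c + 3)) (e' (g (fst (f x), y)))"
proof -
  obtain p1 T1 c1 where T1: "\<And>x. T1 x \<le> c1 * enc_length (e x) ^ c1" and
    p1: "\<And>x s. s 0 = e x \<Longrightarrow> \<exists>n s'. exec p1 s n s' \<and> n \<le> T1 x \<and> s' 0 = (ei \<otimes> em) (f x)"
    using pre unfolding polytime_def ptime_def poly_bounded_def by metis
  obtain p2 T2 c2 where T2: "\<And>x. T2 x \<le> c2 * enc_length ((ei \<otimes> eo) x) ^ c2" and
    p2: "\<And>x s. s 0 = (ei \<otimes> eo) x \<Longrightarrow> \<exists>n s'. exec p2 s n s' \<and> n \<le> T2 x \<and> s' 0 = e' (g x)"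
    using post unfolding polytime_def ptime_def poly_bounded_def by metis
  obtain M where M: "M > 0" "\<And>v. v \<in> vars p1 \<Longrightarrow> v < M"
    using finite_nat_set_iff_bounded[of "insert 0 (vars p1)"] finite_vars[of p1] by auto
  let ?q = "Seq p1 (Seq (SetTl M 0) (Seq (SetHd 0 0) (Seq (rename (\<lambda>v. v + M) p) (Seq (SetPair 0 0 M) p2))))"
  define c where "c = c1 + c2"
  have mono: "a * enc_length d ^ a \<le> c * enc_length d ^ c" if "a \<le> c" for a d
    using that enc_length_pos[of d] by (intro mult_mono power_increasing) auto
  have "outputs_within ?q (e x) (T + real (c * enc_length (e x) ^ c +
      c * enc_length ((ei \<otimes> eo) (fst (f x), y)) ^ c + 3)) (e' (g (fst (f x), y)))"
    if p: "outputs_within p (em (snd (f x))) T (eo y)" for x y T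
  proof -
    let ?s = "(\<lambda>_. Leaf)(0 := e x)"
    obtain n u where n: "exec p1 ?s n u" "n \<le> T1 x" "u 0 = (ei \<otimes> em) (f x)"
      using p1[of ?s x] by auto
    have u0: "u 0 = Pair (ei (fst (f x))) (em (snd (f x)))"
      using n(3) by (cases "f x") simp
    have fresh: "u v = Leaf" if "v \<ge> M" for v
      using exec_frame[OF n(1), of v] M that by force
    let ?u1 = "u(M := tl_data (u 0))"
    let ?u2 = "?u1(0 := hd_data (?u1 0))"
    obtain m w where m: "exec p ((\<lambda>_. Leaf)(0 := em (snd (f x)))) m w" "real m \<le> T" "w 0 = eo y"
      using p unfolding outputs_within_def by blast
    have "(\<lambda>v. ?u2 (v + M)) = (\<lambda>_. Leaf)(0 := em (snd (f x)))"
      using M(1) fresh u0 by (auto simp: fun_eq_iff)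
    then obtain z where z: "exec (rename (\<lambda>v. v + M) p) ?u2 m z" "z M = eo y" "\<forall>v<M. z v = ?u2 v"
      using exec_shift[of p ?u2 M m w] m by auto
    let ?z = "z(0 := Pair (z 0) (z M))"
    have "z 0 = ei (fst (f x))" using z(3) M(1) u0 by simp
    then have "?z 0 = (ei \<otimes> eo) (fst (f x), y)" using z(2) by simp
    then obtain j s where j: "exec p2 ?z j s" "j \<le> T2 (fst (f x), y)" "s 0 = e' (g (fst (f x), y))"
      using p2[of ?z "(fst (f x), y)"] by auto
    have ex: "exec ?q ?s (n + (1 + (1 + (m + (1 + j))))) s"
      by (rule exec.Seq n(1) exec.SetTl exec.SetHd z(1) exec.SetPair j(1))+
    have "n \<le> c * enc_length (e x) ^ c"
      using n(2) T1[of x] mono[of c1 "e x"] by (simp add: c_def)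
    moreover have "j \<le> c * enc_length ((ei \<otimes> eo) (fst (f x), y)) ^ c"
      using j(2) T2[of "(fst (f x), y)"] mono[of c2 "(ei \<otimes> eo) (fst (f x), y)"] by (simp add: c_def)
    ultimately have "real (n + (1 + (1 + (m + (1 + j))))) \<le> T + real (c * enc_length (e x) ^ c +
        c * enc_length ((ei \<otimes> eo) (fst (f x), y)) ^ c + 3)"
      using m(2) by linarith
    then show ?thesis using ex j(3) unfolding outputs_within_def by blast
  qed
  then show ?thesis by blast
qed

section \<open>Size estimates\<close>

lemma enc_length_list_le:
  "(\<And>x. x \<in> set xs \<Longrightarrow> enc_length (e x) \<le> b) \<Longrightarrow> enc_length (enc_list e xs) \<le> 1 + length xs * (1 + b)"
proof (induction xs)
  case (Cons x xs)
  then have "enc_length (enc_list e xs) \<le> 1 + length xs * (1 + b)" "enc_length (e x) \<le> b" by auto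
  then show ?case by simp
qed simp

text \<open>Padding each set with the dummy letter \<open>n\<close> to length \<open>k\<close>
  represents it by a word of length \<open>k\<close> over \<open>n + 1\<close> letters, and the sets
  are distinct.\<close>

lemma sc_family_length:
  assumes "(n, F, t) \<in> sc_instances k"
  shows "length F \<le> (n + 1) ^ k"
proof -
  let ?X = "{xs. set xs \<subseteq> {..n} \<and> length xs = k}"
  have F: "distinct S" "set S \<subseteq> {..<n}" "card (set S) \<le> k" if "S \<in> set F" for S
    using assms that by (auto simp: sc_instances_def)
  have "set (map set F) \<subseteq> (\<lambda>xs. set xs \<inter> {..<n}) ` ?X"
  proof
    fix A assume "A \<in> set (map set F)"
    then obtain S where S: "S \<in> set F" "A = set S" by auto
    have "length S \<le> k" using F[OF S(1)] distinct_card by fastforce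
    then have "S @ replicate (k - length S) n \<in> ?X" using F(2)[OF S(1)] by auto
    moreover have "set (S @ replicate (k - length S) n) \<inter> {..<n} = A"
      using F(2)[OF S(1)] S(2) by auto
    ultimately show "A \<in> (\<lambda>xs. set xs \<inter> {..<n}) ` ?X" by blast
  qed
  then have "card (set (map set F)) \<le> card ((\<lambda>xs. set xs \<inter> {..<n}) ` ?X)"
    by (intro card_mono finite_imageI finite_lists_length_eq) auto
  also have "\<dots> \<le> card ?X" by (intro card_image_le finite_lists_length_eq) auto
  also have "\<dots> = (n + 1) ^ k" by (subst card_lists_length_eq) auto
  finally show ?thesis using assms distinct_card[of "map set F"] by (simp add: sc_instances_def)
qed

lemma enc_length_sc:
  assumes "(n, F, t) \<in> sc_instances k"
  shows "enc_length (enc_sc (n, F, t)) \<le> (5 * k + 13) * (n + 1) ^ (k + 1)"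
proof -
  let ?N = "n + 1"
  have nat: "enc_length (enc_nat u) \<le> 4 * ?N" if "u \<le> n" for u
    using enc_length_nat[of u] that by simp
  have "enc_length (enc_list enc_nat S) \<le> (5 * k + 1) * ?N" if "S \<in> set F" for S
  proof -
    have S: "distinct S" "set S \<subseteq> {..<n}" "card (set S) \<le> k"
      using assms that by (auto simp: sc_instances_def)
    then have len: "length S \<le> k" using distinct_card by fastforce
    have "enc_length (enc_list enc_nat S) \<le> 1 + length S * (1 + 4 * ?N)"
      using S(2) by (intro enc_length_list_le nat) auto
    also have "\<dots> \<le> 1 + k * (5 * ?N)" using len by (intro add_left_mono mult_mono) auto
    also have "\<dots> \<le> (5 * k + 1) * ?N" by (simp add: algebra_simps)
    finally show ?thesis .
  qed
  then have "enc_length (enc_list (enc_list enc_nat) F) \<le> 1 + length F * (1 + (5 * k + 1) * ?N)"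
    by (rule enc_length_list_le)
  also have "\<dots> \<le> 1 + ?N ^ k * ((5 * k + 2) * ?N)"
    using sc_family_length[OF assms] by (intro add_left_mono mult_mono) auto
  finally have F: "enc_length (enc_list (enc_list enc_nat) F) \<le> 1 + (5 * k + 2) * ?N ^ (k + 1)"
    by (simp add: algebra_simps)
  have "t \<le> n" using assms by (simp add: sc_instances_def)
  then have "enc_length (enc_sc (n, F, t)) \<le> 3 + 8 * ?N + (5 * k + 2) * ?N ^ (k + 1)"
    using F nat[of n] nat[of t] by (simp add: enc_sc_def)
  also have "\<dots> \<le> 11 * ?N ^ (k + 1) + (5 * k + 2) * ?N ^ (k + 1)"
  proof -
    have "?N \<le> ?N ^ (k + 1)" by (rule self_le_power) auto
    moreover have "3 + 8 * a \<le> 11 * b" if "a \<le> b" "1 \<le> a" for a b :: nat using that by linarith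
    ultimately have "3 + 8 * ?N \<le> 11 * ?N ^ (k + 1)" by simp
    then show ?thesis by (rule add_right_mono)
  qed
  finally show ?thesis by (simp add: algebra_simps)
qed

lemma polynomial_le_exponential:
  fixes \<delta> :: real
  assumes "\<delta> > 0"
  shows "\<exists>B\<ge>0. \<forall>n. real (a * (1 + 2 * n) ^ a) \<le> B * 2 powr (\<delta> * real n)"
proof -
  \<comment> \<open>With this choice the power \<open>Suc a\<close> of \<open>exp (c * n)\<close> is
    \<open>2 powr (\<delta> * n)\<close>, and \<open>c * n \<le> exp (c * n)\<close> bounds the
    linear term. \<open>Suc a\<close> avoids a division by zero for \<open>a = 0\<close>.\<close>
  define c where "c = \<delta> * ln 2 / real (Suc a)"
  have c: "c > 0" using assms by (simp add: c_def)
  let ?B = "real a * (1 + 2 / c) ^ Suc a"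
  have "real (a * (1 + 2 * n) ^ a) \<le> ?B * 2 powr (\<delta> * real n)" for n
  proof -
    let ?E = "exp (c * real n)"
    have "c * real n \<le> ?E" using exp_ge_add_one_self[of "c * real n"] by linarith
    then have "real n \<le> ?E / c" using c by (simp add: field_simps)
    moreover have "1 \<le> ?E" using c by simp
    ultimately have "1 + 2 * real n \<le> ?E + 2 * (?E / c)" by linarith
    also have "\<dots> = (1 + 2 / c) * ?E" by (simp add: algebra_simps)
    finally have le: "1 + 2 * real n \<le> (1 + 2 / c) * ?E" .
    have "real (a * (1 + 2 * n) ^ a) = real a * (1 + 2 * real n) ^ a" by simp
    also have "\<dots> \<le> real a * (1 + 2 * real n) ^ Suc a"
      by (intro mult_left_mono power_increasing) auto
    also have "\<dots> \<le> real a * ((1 + 2 / c) * ?E) ^ Suc a"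
      using le by (intro mult_left_mono power_mono) auto
    also have "\<dots> = ?B * ?E ^ Suc a" by (simp only: power_mult_distrib mult.assoc)
    also have "?E ^ Suc a = 2 powr (\<delta> * real n)"
    proof -
      have "?E ^ Suc a = exp (real (Suc a) * (c * real n))" by (rule exp_of_nat_mult[symmetric])
      also have "real (Suc a) * (c * real n) = \<delta> * real n * ln 2" by (simp add: c_def)
      finally show ?thesis by (simp add: powr_def)
    qed
    finally show ?thesis .
  qed
  moreover have "?B \<ge> 0" using c by simp
  ultimately show ?thesis by blast
qed

lemma length_le_enc_length_pt: "length I \<le> enc_length (enc_pt I)"
  unfolding enc_pt_def by (rule length_le_enc_length)

text \<open>Because of sharing, running time does not polynomially bound an output tree; the size of
  the solver's answer is bounded by its correctness instead, one repetition-free list of nodes per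
  node.\<close>

lemma enc_length_parent_lists:
  assumes "length Ps = L" "\<And>P. P \<in> set Ps \<Longrightarrow> distinct P \<and> set P \<subseteq> {..<L}"
  shows "enc_length (enc_list (enc_list enc_nat) Ps) \<le> 1 + L * (2 + L * (4 * L + 2))"
proof -
  have "enc_length (enc_list enc_nat P) \<le> 1 + L * (4 * L + 2)" if "P \<in> set Ps" for P
  proof -
    have P: "distinct P" "set P \<subseteq> {..<L}" using assms(2)[OF that] by auto
    have "length P \<le> L" using P distinct_card[of P] card_mono[of "{..<L}" "set P"] by simp
    have "enc_length (enc_nat u) \<le> 4 * L + 1" if "u \<in> set P" for u
      using enc_length_nat[of u] P(2) that by fastforce
    then have "enc_length (enc_list enc_nat P) \<le> 1 + length P * (1 + (4 * L + 1))"
      by (rule enc_length_list_le)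
    also have "\<dots> \<le> 1 + L * (4 * L + 2)" using \<open>length P \<le> L\<close> by (intro add_left_mono mult_mono) auto
    finally show ?thesis .
  qed
  from enc_length_list_le[of Ps "enc_list enc_nat", OF this] show ?thesis using assms(1) by simp
qed

text \<open>The second claim is the node count \<open>n + n / (r + 1) + r + 2\<close>, multiplied by
  \<open>r + 1\<close> to stay within the natural numbers.\<close>

lemma preprocess_correct:
  assumes z: "(n, F, t) \<in> sc_instances k"
    and pre: "preprocess r (Suc r * k) (n, F, t) = (info, I)"
  shows "I \<in> pt_le_instances (Suc (Suc r * k))"
    and "Suc r * length I \<le> Suc (Suc r) * n + Suc r * (Suc r + 1)"
    and "max_score_polytree I A \<Longrightarrow> length Ps = length I \<Longrightarrow>
      \<forall>v\<in>nodes I. set (Ps ! v) = parents A v \<Longrightarrow> postprocess (info, Ps) = has_set_cover (n, F, t)"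
proof -
  let ?W = "suffix_of_length n (0 # concat F)" and ?X = "suffix_of_length t ([] # F)"
  let ?cs = "map (\<lambda>b. if b then Suc r else 1) (blocks r ?X)"
  let ?ok = "length ?W = n \<and> length ?X = t"
  have pre': "info = (?ok, [0..<length ?W])" "I = (if ?ok then reduction (Suc r * k) (length ?W) F ?cs else [])"
    using pre by (auto simp: preprocess_def Let_def)
  have "t \<le> n" using z by (simp add: sc_instances_def)
  have X: "length ?X = t \<longleftrightarrow> t \<le> length F"
    by (auto simp: length_suffix_of_length)
  have W: "length ?W = n \<longleftrightarrow> n \<le> length (concat F)"
    by (auto simp: length_suffix_of_length)
  \<comment> \<open>If the test fails, the family has fewer than \<open>t\<close> sets or total size
    below \<open>n\<close>.\<close>
  have nok: "\<not> has_set_cover (n, F, t)" if "\<not> ?ok"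
  proof
    assume "has_set_cover (n, F, t)"
    then obtain C where C: "C \<subseteq> set ` set F" "card C = t" "\<Union>C = {..<n}"
      by (auto simp: has_set_cover_def)
    have "t \<le> card (set ` set F)" using C card_mono[of "set ` set F" C] by simp
    also have "\<dots> \<le> card (set F)" by (rule card_image_le) simp
    also have "\<dots> \<le> length F" by (rule card_length)
    finally have "length ?X = t" using X by simp
    have "{..<n} \<subseteq> set (concat F)" using Union_mono[OF C(1)] C(3) by simp
    then have "n \<le> card (set (concat F))" using card_mono[of "set (concat F)" "{..<n}"] by simp
    also have "\<dots> \<le> length (concat F)" by (rule card_length)
    finally have "length ?W = n" using W by simp
    then show False using that \<open>length ?X = t\<close> by simp
  qed
  have red: "set_cover_reduction k n t (Suc r) (Suc r * k) F ?cs" if ?ok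
  proof
    show "sum_list ?cs = t" using blocks_weights(1)[of r ?X] that by simp
  qed (use z in auto)
  show "I \<in> pt_le_instances (Suc (Suc r * k))"
  proof (cases ?ok)
    case True
    then show ?thesis using set_cover_reduction.I_valid[OF red] pre'(2) by simp
  next
    case False
    then have "I = []" unfolding pre'(2) by (rule if_not_P)
    then show ?thesis by (simp add: pt_le_instances_def pt_instances_def nodes_def)
  qed
  show "Suc r * length I \<le> Suc (Suc r) * n + Suc r * (Suc r + 1)"
  proof (cases ?ok)
    case True
    have "length I = n + 1 + length (blocks r ?X)"
      unfolding pre'(2) if_P[OF True] using True by (simp add: reduction_def)
    moreover have "Suc r * length (blocks r ?X) \<le> n + Suc r * Suc r"
      using blocks_weights(2)[of r ?X] True \<open>t \<le> n\<close> by simp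
    ultimately show ?thesis by (simp add: algebra_simps)
  next
    case False
    then have "I = []" unfolding pre'(2) by (rule if_not_P)
    then show ?thesis by simp
  qed
  assume max: "max_score_polytree I A" and Ps: "length Ps = length I"
    "\<forall>v\<in>nodes I. set (Ps ! v) = parents A v"
  show "postprocess (info, Ps) = has_set_cover (n, F, t)"
  proof (cases ?ok)
    case True
    have I: "I = reduction (Suc r * k) n F ?cs"
      unfolding pre'(2) if_P[OF True] using True by simp
    have t: "t \<le> length F" using X True by blast
    have "(\<exists>P\<in>set Ps. u \<in> set P) \<longleftrightarrow> (\<exists>v\<in>nodes I. u \<in> parents A v)" for u
    proof -
      have "(\<exists>P\<in>set Ps. u \<in> set P) \<longleftrightarrow> (\<exists>v<length I. u \<in> set (Ps ! v))"
        using Ps(1) by (metis in_set_conv_nth)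
      then show ?thesis using Ps(2) unfolding nodes_def by auto
    qed
    then have "postprocess (info, Ps) \<longleftrightarrow> (\<forall>u<n. \<exists>v\<in>nodes I. u \<in> parents A v)"
      using True by (auto simp: postprocess_def pre'(1))
    also have "\<dots> \<longleftrightarrow> has_set_cover (n, F, t)"
      using set_cover_reduction.max_score_polytree_covers_iff[OF red[OF True] max[unfolded I]]
        set_cover_reduction.has_set_cover_iff[OF red[OF True]] t
      unfolding I by simp
    finally show ?thesis .
  next
    case False
    then have "\<not> postprocess (info, Ps)" unfolding postprocess_def pre'(1) fst_conv by blast
    then show ?thesis using nok[OF False] by blast
  qed
qed

lemma outputs_within_mono: "outputs_within p x T y \<Longrightarrow> T \<le> T' \<Longrightarrow> outputs_within p x T' y"
  unfolding outputs_within_def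
  by (elim exE conjE, intro exI conjI, assumption) (linarith, assumption)

text \<open>Half of the gain \<open>\<epsilon>\<close> is spent: one quarter pays for the additional
  \<open>n / (r + 1)\<close> nodes by the choice of \<open>r\<close>, another for all polynomial
  factors.\<close>

lemma set_cover_solvable:
  fixes \<epsilon> :: real
  assumes \<epsilon>: "0 < \<epsilon>" "\<epsilon> < 1" and r: "(1 - \<epsilon>) / real (Suc r) \<le> \<epsilon> / 4"
    and sol: "pt_solvable \<epsilon> (pt_le_instances (Suc (Suc r * k)))"
  shows "\<exists>p C. solves_in_time p (sc_instances k) enc_sc sc_correct
    (\<lambda>(n, F, t). C * 2 powr ((1 - \<epsilon> / 2) * real n))"
proof -
  let ?K = "Suc r * k"
  let ?ei = "enc_bool \<otimes> enc_list enc_nat" and ?eo = "enc_list (enc_list enc_nat)"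
  obtain p C c0 where p: "\<And>I. I \<in> pt_le_instances (Suc ?K) \<Longrightarrow>
      \<exists>y. outputs_within p (enc_pt I) (C * 2 powr ((1 - \<epsilon>) * real (card (nodes I))) *
        real (enc_length (enc_pt I)) ^ c0) y \<and> pt_correct I y"
    using sol unfolding pt_solvable_def solves_in_time_def by blast
  obtain q c where q: "\<And>z y T. outputs_within p (enc_pt (snd (preprocess r ?K z))) T (?eo y) \<Longrightarrow>
      outputs_within q (enc_sc z) (T + real (c * enc_length (enc_sc z) ^ c +
        c * enc_length ((?ei \<otimes> ?eo) (fst (preprocess r ?K z), y)) ^ c + 3))
        (enc_bool (postprocess (fst (preprocess r ?K z), y)))"
    using outputs_within_wrap[OF polytime_preprocess[of r ?K] polytime_postprocess, of p] by blast
  obtain c1 where c1: "\<And>z. enc_length ((?ei \<otimes> enc_pt) (preprocess r ?K z)) \<le>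
      c1 * enc_length (enc_sc z) ^ c1"
    using polytime_size[OF polytime_preprocess[of r ?K]] unfolding poly_bounded_def by blast
  \<comment> \<open>An artificial unary encoding of the universe size, which makes the calculus of
    \<open>poly_bounded\<close> yield polynomials in \<open>n\<close> rather than in the input
    length.\<close>
  define eN :: "sc_instance \<Rightarrow> data" where
    "eN = (\<lambda>z. enc_list enc_bool (replicate (fst z) False))"
  have eN: "enc_length (eN z) = 1 + 2 * fst z" for z
  proof -
    have "enc_length (enc_list enc_bool (replicate m False)) = 1 + 2 * m" for m
      by (induction m) auto
    then show ?thesis by (simp add: eN_def)
  qed
  \<comment> \<open>\<open>poly_bounded\<close> ranges over all arguments, but the size estimate in
    \<open>n\<close> is available only for valid instances; the others get size 0.\<close>
  define s where "s z = (if z \<in> sc_instances k then enc_length (enc_sc z) else 0)" for z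
  have s: "poly_bounded eN s"
  proof (rule poly_bounded_mono)
    show "poly_bounded eN (\<lambda>z. (5 * k + 13) * enc_length (eN z) ^ (k + 1))"
      by (intro poly_bounded_intros)
    fix z :: sc_instance
    obtain n F t where z: "z = (n, F, t)" by (cases z)
    show "s z \<le> (5 * k + 13) * enc_length (eN z) ^ (k + 1)"
    proof (cases "z \<in> sc_instances k")
      case True
      have "s z \<le> (5 * k + 13) * (n + 1) ^ (k + 1)"
        using True enc_length_sc[of n F t k] by (simp add: s_def z)
      also have "\<dots> \<le> (5 * k + 13) * enc_length (eN z) ^ (k + 1)"
        unfolding eN by (intro mult_left_mono power_mono) (auto simp: z)
      finally show ?thesis .
    qed (simp add: s_def)
  qed
  \<comment> \<open>\<open>Q\<close> bounds the instance handed to the solver, and \<open>H\<close>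
    the time spent before and after it, with the size of the answer expressed by
    \<open>Q\<close>.\<close>
  define Q where "Q z = c1 * s z ^ c1" for z
  define H where "H z = c * s z ^ c + c * (2 + Q z + Q z * (2 + Q z * (4 * Q z + 2))) ^ c + 3" for z
  have "poly_bounded eN (\<lambda>z. Q z ^ c0 + H z)"
    unfolding Q_def H_def by (intro poly_bounded_intros s)
  then obtain a where a: "\<And>z. Q z ^ c0 + H z \<le> a * (1 + 2 * fst z) ^ a"
    unfolding poly_bounded_def eN by blast
  have "\<epsilon> / 4 > 0" using \<epsilon> by simp
  from polynomial_le_exponential[OF this, of a]
  obtain B where B: "B \<ge> 0" "\<And>n. real (a * (1 + 2 * n) ^ a) \<le> B * 2 powr (\<epsilon> / 4 * real n)"
    by blast
  \<comment> \<open>\<open>D\<close> absorbs the \<open>r + 2\<close> nodes that do not grow with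
    \<open>n\<close>.\<close>
  define D where "D = 2 powr ((1 - \<epsilon>) * (real r + 2))"
  let ?C = "\<bar>C\<bar> * D * B + B"
  have "solves_in_time q (sc_instances k) enc_sc sc_correct
      (\<lambda>(n, F, t). ?C * 2 powr ((1 - \<epsilon> / 2) * real n))"
    unfolding solves_in_time_def
  proof
    fix z assume z: "z \<in> sc_instances k"
    obtain n F t where nFt: "z = (n, F, t)" by (cases z)
    obtain info I where pre: "preprocess r ?K z = (info, I)" by fastforce
    note correct = preprocess_correct[OF z[unfolded nFt] pre[unfolded nFt]]
    let ?T = "C * 2 powr ((1 - \<epsilon>) * real (card (nodes I))) * real (enc_length (enc_pt I)) ^ c0"
    obtain y where y: "outputs_within p (enc_pt I) ?T y" "pt_correct I y"
      using p[OF correct(1)] by blast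
    then obtain A Ps where A: "max_score_polytree I A" and len: "length Ps = length I"
      and Ps: "\<forall>v\<in>nodes I. distinct (Ps ! v) \<and> set (Ps ! v) = parents A v" and y_eq: "y = ?eo Ps"
      unfolding pt_correct_def by blast
    have out: "postprocess (info, Ps) = has_set_cover z"
      unfolding nFt using correct(3)[OF A len] Ps by blast
    let ?T' = "?T + real (c * enc_length (enc_sc z) ^ c + c * enc_length ((?ei \<otimes> ?eo) (info, Ps)) ^ c + 3)"
    have run: "outputs_within q (enc_sc z) ?T' (enc_bool (has_set_cover z))"
      using q[of z ?T Ps] y(1) out unfolding y_eq pre fst_conv snd_conv by simp
    have sz: "enc_length (enc_sc z) = s z" using z by (simp add: s_def)
    have Q: "1 + enc_length (?ei info) + enc_length (enc_pt I) \<le> Q z"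
      using c1[of z] unfolding pre Q_def sz[symmetric] by simp
    have "length I \<le> Q z" using Q length_le_enc_length_pt[of I] by linarith
    have "enc_length (?eo Ps) \<le> 1 + length I * (2 + length I * (4 * length I + 2))"
    proof (rule enc_length_parent_lists[OF len])
      fix P assume "P \<in> set Ps"
      then obtain v where v: "v < length I" "P = Ps ! v" using len by (metis in_set_conv_nth)
      have "A \<subseteq> nodes I \<times> nodes I"
        using A by (simp add: max_score_polytree_def polytree_def dag_def)
      then have "parents A v \<subseteq> {..<length I}" by (auto simp: parents_def nodes_def)
      then show "distinct P \<and> set P \<subseteq> {..<length I}" using Ps v by (simp add: nodes_def)
    qed
    also have "\<dots> \<le> 1 + Q z * (2 + Q z * (4 * Q z + 2))"
      using \<open>length I \<le> Q z\<close> by (intro add_left_mono add_right_mono mult_mono) auto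
    finally have "enc_length ((?ei \<otimes> ?eo) (info, Ps)) \<le> 2 + Q z + Q z * (2 + Q z * (4 * Q z + 2))"
      using Q by simp
    then have H: "c * enc_length (enc_sc z) ^ c + c * enc_length ((?ei \<otimes> ?eo) (info, Ps)) ^ c + 3 \<le> H z"
      unfolding H_def sz by (intro add_mono mult_left_mono power_mono) auto
    have G: "enc_length (enc_pt I) ^ c0 \<le> Q z ^ c0"
      using Q by (intro power_mono) auto
    let ?E = "B * 2 powr (\<epsilon> / 4 * real n)"
    have GH: "real (Q z ^ c0) \<le> ?E" "real (H z) \<le> ?E"
    proof -
      have "real (Q z ^ c0 + H z) \<le> real (a * (1 + 2 * n) ^ a)"
        using a[of z] nFt by (simp del: of_nat_add of_nat_mult of_nat_power)
      then have "real (Q z ^ c0 + H z) \<le> ?E" using B(2)[of n] by linarith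
      then show "real (Q z ^ c0) \<le> ?E" "real (H z) \<le> ?E"
        using of_nat_0_le_iff[of "Q z ^ c0", where ?'a = real] of_nat_0_le_iff[of "H z", where ?'a = real]
        by (simp_all only: of_nat_add)
    qed
    have expo: "2 powr ((1 - \<epsilon>) * real (card (nodes I))) \<le> D * 2 powr ((1 - \<epsilon> + \<epsilon> / 4) * real n)"
    proof -
      let ?r = "real (Suc r)"
      have "real (Suc r * length I) \<le> real (Suc (Suc r) * n + Suc r * (Suc r + 1))"
        using correct(2) by (rule of_nat_mono)
      moreover have "?r * (real n / ?r) = real n" by simp
      then have "?r * (real n + real n / ?r + (real r + 2)) =
          real (Suc (Suc r) * n + Suc r * (Suc r + 1))"
        unfolding distrib_left by (simp add: algebra_simps)
      ultimately have "?r * real (length I) \<le> ?r * (real n + real n / ?r + (real r + 2))"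
        by (simp only: of_nat_mult)
      then have "real (length I) \<le> real n + real n / ?r + (real r + 2)"
        by (rule mult_left_le_imp_le) simp
      then have "(1 - \<epsilon>) * real (length I) \<le> (1 - \<epsilon>) * (real n + real n / ?r + (real r + 2))"
        using \<epsilon> by (intro mult_left_mono) auto
      also have "\<dots> = (1 - \<epsilon>) * real n + (1 - \<epsilon>) / ?r * real n + (1 - \<epsilon>) * (real r + 2)"
        by (simp only: distrib_left times_divide_eq_right times_divide_eq_left)
      also have "\<dots> \<le> (1 - \<epsilon>) * real n + \<epsilon> / 4 * real n + (1 - \<epsilon>) * (real r + 2)"
        using r by (intro add_mono mult_right_mono) auto
      finally have "(1 - \<epsilon>) * real (length I) \<le>
          (1 - \<epsilon>) * (real r + 2) + (1 - \<epsilon> + \<epsilon> / 4) * real n"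
        by (simp add: algebra_simps)
      then have "2 powr ((1 - \<epsilon>) * real (length I)) \<le>
          2 powr ((1 - \<epsilon>) * (real r + 2) + (1 - \<epsilon> + \<epsilon> / 4) * real n)"
        by (rule powr_mono) simp
      then show ?thesis by (simp add: nodes_def D_def powr_add)
    qed
    have "?T \<le> \<bar>C\<bar> * (D * 2 powr ((1 - \<epsilon> + \<epsilon> / 4) * real n)) * ?E"
    proof -
      have "real (enc_length (enc_pt I)) ^ c0 \<le> real (Q z ^ c0)"
        using G by (metis of_nat_le_iff of_nat_power)
      then have "real (enc_length (enc_pt I)) ^ c0 \<le> ?E" using GH(1) by linarith
      then show ?thesis using expo by (intro mult_mono) (auto simp: D_def)
    qed
    also have "\<dots> = \<bar>C\<bar> * D * B * 2 powr ((1 - \<epsilon> / 2) * real n)"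
    proof -
      have "(1 - \<epsilon> + \<epsilon> / 4) * real n + \<epsilon> / 4 * real n = (1 - \<epsilon> / 2) * real n"
        by (simp add: algebra_simps)
      then have "2 powr ((1 - \<epsilon> + \<epsilon> / 4) * real n) * 2 powr (\<epsilon> / 4 * real n) =
          2 powr ((1 - \<epsilon> / 2) * real n)"
        by (simp only: powr_add[symmetric])
      then show ?thesis by (simp only: mult.assoc mult.left_commute)
    qed
    finally have T: "?T \<le> \<bar>C\<bar> * D * B * 2 powr ((1 - \<epsilon> / 2) * real n)" .
    have "real (H z) \<le> B * 2 powr ((1 - \<epsilon> / 2) * real n)"
    proof -
      have "2 powr (\<epsilon> / 4 * real n) \<le> 2 powr ((1 - \<epsilon> / 2) * real n)"
        using \<epsilon> by (intro powr_mono mult_right_mono) auto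
      then have "?E \<le> B * 2 powr ((1 - \<epsilon> / 2) * real n)" using B(1) by (rule mult_left_mono)
      then show ?thesis using GH(2) by linarith
    qed
    moreover have "real (c * enc_length (enc_sc z) ^ c + c * enc_length ((?ei \<otimes> ?eo) (info, Ps)) ^ c + 3)
        \<le> real (H z)"
      using H by (rule of_nat_mono)
    ultimately have "?T' \<le> ?C * 2 powr ((1 - \<epsilon> / 2) * real n)"
      using T unfolding distrib_right by linarith
    then have "outputs_within q (enc_sc z) (?C * 2 powr ((1 - \<epsilon> / 2) * real n)) (enc_bool (has_set_cover z))"
      using run by (rule outputs_within_mono[rotated])
    then show "\<exists>y. outputs_within q (enc_sc z)
        ((\<lambda>(n, F, t). ?C * 2 powr ((1 - \<epsilon> / 2) * real n)) z) y \<and> sc_correct z y"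
      unfolding nFt by (auto simp: sc_correct_def)
  qed
  then show ?thesis by blast
qed

lemma pt_solvable_mono:
  assumes "pt_solvable \<epsilon> J" "J' \<subseteq> J" "\<epsilon>' \<le> \<epsilon>"
  shows "pt_solvable \<epsilon>' J'"
proof -
  obtain p C c where p: "solves_in_time p J enc_pt pt_correct
    (\<lambda>I. C * 2 powr ((1 - \<epsilon>) * real (card (nodes I))) * real (enc_length (enc_pt I)) ^ c)"
    using assms(1) unfolding pt_solvable_def by blast
  \<comment> \<open>The constant of the given bound may be negative, and then enlarging the other
    factors would lower the bound; the absolute value avoids this.\<close>
  have "C * 2 powr ((1 - \<epsilon>) * real (card (nodes I))) * real (enc_length (enc_pt I)) ^ c \<le>
      \<bar>C\<bar> * 2 powr ((1 - \<epsilon>') * real (card (nodes I))) * real (enc_length (enc_pt I)) ^ c" for I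
    using assms(3) by (intro mult_mono powr_mono mult_right_mono) auto
  then have "solves_in_time p J' enc_pt pt_correct
    (\<lambda>I. \<bar>C\<bar> * 2 powr ((1 - \<epsilon>') * real (card (nodes I))) * real (enc_length (enc_pt I)) ^ c)"
    using p assms(2) outputs_within_mono unfolding solves_in_time_def by (meson subsetD)
  then show ?thesis unfolding pt_solvable_def by blast
qed

theorem theorem3p5:
  assumes "set_cover_conjecture"
  shows "(\<forall>\<epsilon>::real. \<epsilon> > 0 \<longrightarrow> (\<exists>k. \<not> pt_solvable \<epsilon> (pt_le_instances k))) \<and>
         (\<forall>\<epsilon>::real. \<epsilon> > 0 \<longrightarrow> \<not> pt_solvable \<epsilon> pt_instances)"
proof -
  have bounded: "\<exists>k. \<not> pt_solvable \<epsilon> (pt_le_instances k)" if "\<epsilon> > 0" for \<epsilon> :: real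
  proof -
    \<comment> \<open>Capping at 1/2 keeps \<open>1 - \<delta>\<close> positive for the exponent
      arithmetic of the reduction; a larger \<open>\<epsilon>\<close> only asks for a faster
      algorithm.\<close>
    define \<delta> where "\<delta> = min \<epsilon> (1 / 2)"
    have \<delta>: "0 < \<delta>" "\<delta> < 1" "\<delta> \<le> \<epsilon>" using that by (auto simp: \<delta>_def)
    \<comment> \<open>The conjecture is invoked at \<open>\<delta> / 2\<close>, the gain that
      survives the reduction.\<close>
    obtain k where k: "\<nexists>p C. solves_in_time p (sc_instances k) enc_sc sc_correct
        (\<lambda>(n, F, t). C * 2 powr ((1 - \<delta> / 2) * real n))"
      using assms \<delta>(1) unfolding set_cover_conjecture_def by (meson half_gt_zero)
    obtain r :: nat where r: "4 * (1 - \<delta>) / \<delta> < real r" using reals_Archimedean2 by blast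
    have "(1 - \<delta>) / real (Suc r) \<le> \<delta> / 4"
      using r \<delta> by (simp add: field_simps)
    then have "\<not> pt_solvable \<delta> (pt_le_instances (Suc (Suc r * k)))"
      using set_cover_solvable[OF \<delta>(1,2)] k by blast
    then show ?thesis using pt_solvable_mono[OF _ subset_refl \<delta>(3)] by blast
  qed
  moreover have "\<not> pt_solvable \<epsilon> pt_instances" if pos: "\<epsilon> > 0" for \<epsilon> :: real
  proof
    assume sol: "pt_solvable \<epsilon> pt_instances"
    obtain k where k: "\<not> pt_solvable \<epsilon> (pt_le_instances k)" using bounded[OF pos] by (elim exE)
    have "pt_le_instances k \<subseteq> pt_instances" by (simp add: pt_le_instances_def)
    then show False using pt_solvable_mono[OF sol _ order.refl] k by simp
  qed
  ultimately show ?thesis by blast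
qed

end
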